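(* Assume $W_c$ satisfies Assumption 2, let $r>0$, and suppose \[rH^{W_s}(M)+H^{W_c}(X|Z)<R<rH^{W_s}_0(M)+H^{W_c,\uparrow}_0(X|Z).\] Let $U^\uparrow:=U[W_s,W_c,\uparrow;r]$ and let $\theta_0\in(0,1)$ satisfy $(1-\theta_0)(U^\uparrow)'(\theta_0)+U^\uparrow(\theta_0)=R$. Then \[ \limsup_{n\to\infty}-\frac1n\log P_j(\lfloor rn\rfloor,n)\le\theta_0(U^\uparrow)'(\theta_0)-U^\uparrow(\theta_0)=\sup_{0\le\theta<1}\frac{\theta R-U^\uparrow(\theta)}{1-\theta}. \]
   Context: Setup. $\mathcal M$ finite, $W_s$ an irreducible aperiodic transition matrix on $\mathcal M$; message $M^k$ with law $P_{M_1}(m_1)\prod_{i=2}^kW_s(m_i|m_{i-1})$. $\mathcal X$ a finite abelian group, $\mathcal Z$ finite, $W_c=\{W_c(x,z|x',z')\}$ an irreducible aperiodic transition matrix on $\mathcal X\times\mathcal Z$; noise $(X^n,Z^n)$ with law $P_{X_1Z_1}(x_1,z_1)\prod_{i=2}^nW_c(x_i,z_i|x_{i-1},z_{i-1})$. Channel: input $\tilde x^n$ yields output $(x^n,z^n)$ with probability $P_{X^nZ^n}(x^n-\tilde x^n,z^n)$. $P_j(k,n)$ is the minimum over codes $(\mathsf e:\mathcal M^k\to\mathcal X^n,\ \mathsf d:(\mathcal X\times\mathcal Z)^n\to\mathcal M^k)$ of the average decoding error probability. $R:=\log|\mathcal X|$. Assumption 2: either (i) for every $\theta\in(-\infty,1)$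 and $z,z'$, $\sum_xW_c(x,z|x',z')^{1-\theta}$ does not depend on $x'$, or (ii) $|\mathcal Z|=1$; in either case $W_{c,Z}(z|z'):=\sum_xW_c(x,z|x',z')$ is independent of $x'$. Entrywise powers $a^t$ of transition probabilities are $0$ when $a=0$; $\lambda(A)$ denotes the Perron–Frobenius eigenvalue. $\theta H^{W_s}_{1-\theta}(M):=\log\lambda\big(W_s(m|m')^{1-\theta}\big)$. For transition matrices $V$ on $\mathcal Z$ with $V(z|z')>0$ whenever $W_{c,Z}(z|z')>0$: $H^{W_c|V}_{1-\theta}(X|Z):=\frac1\theta\log\lambda\big(W_c(x,z|x',z')^{1-\theta}V(z|z')^\theta\big)$, $H^{W_c,\uparrow}_{1-\theta}(X|Z):=\max_VH^{W_c|V}_{1-\theta}(X|Z)$, $H^{W_c,\downarrow}_{1-\theta}(X|Z):=H^{W_c|W_{c,Z}}_{1-\theta}(X|Z)$. $H^{W_s}(M)$, $H^{W_c}(X|Z)$ are the limits $\theta\to0$ of $H^{W_s}_{1-\theta}(M)$, $H^{W_c,\downarrow}_{1-\theta}(X|Z)$; $H^{W_s}_0(M)$, $H^{W_c,\uparrow}_0(X|Z)$ are the values at $\theta=1$. $U[W_s,W_c,\uparrow;r](\theta):=r\theta H^{W_s}_{1-\theta}(M)+\theta H^{W_c,\uparrow}_{1-\theta}(X|Z)$. *)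

theory Defs
  imports "HOL-Analysis.Analysis"
begin

text \<open>Conventions: a matrix/transition kernel on a finite type 'i is a function
  W :: 'i \<Rightarrow> 'i \<Rightarrow> real, with W a b read as W(a|b).
  Entrywise powers use powr, for which 0 powr t = 0 (the paper's convention).
  Logarithms are natural logarithms (ln) throughout.\<close>

definition transition_matrix :: "('i::finite \<Rightarrow> 'i \<Rightarrow> real) \<Rightarrow> bool" where
  "transition_matrix W \<longleftrightarrow> (\<forall>a b. 0 \<le> W a b) \<and> (\<forall>b. (\<Sum>a\<in>UNIV. W a b) = 1)"

fun matpow :: "('i::finite \<Rightarrow> 'i \<Rightarrow> real) \<Rightarrow> nat \<Rightarrow> 'i \<Rightarrow> 'i \<Rightarrow> real" where
  "matpow A 0 = (\<lambda>a b. if a = b then 1 else 0)"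
| "matpow A (Suc k) = (\<lambda>a b. \<Sum>c\<in>UNIV. A a c * matpow A k c b)"

definition irreducible_mat :: "('i::finite \<Rightarrow> 'i \<Rightarrow> real) \<Rightarrow> bool" where
  "irreducible_mat A \<longleftrightarrow> (\<forall>a b. \<exists>k>0. matpow A k a b > 0)"

definition aperiodic_mat :: "('i::finite \<Rightarrow> 'i \<Rightarrow> real) \<Rightarrow> bool" where
  "aperiodic_mat A \<longleftrightarrow> (\<forall>a. Gcd {k::nat. k > 0 \<and> matpow A k a a > 0} = 1)"

definition irred_aperiodic_transition :: "('i::finite \<Rightarrow> 'i \<Rightarrow> real) \<Rightarrow> bool" where
  "irred_aperiodic_transition W \<longleftrightarrow> transition_matrix W \<and> irreducible_mat W \<and> aperiodic_mat W"

definition distribution :: "('i::finite \<Rightarrow> real) \<Rightarrow> bool" where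
  "distribution P \<longleftrightarrow> (\<forall>a. 0 \<le> P a) \<and> (\<Sum>a\<in>UNIV. P a) = 1"

text \<open>Perron--Frobenius eigenvalue of a nonnegative matrix = its spectral radius
  (largest modulus of a complex eigenvalue).\<close>
definition pf_eig :: "('i::finite \<Rightarrow> 'i \<Rightarrow> real) \<Rightarrow> real" where
  "pf_eig A = Max {cmod c | c. \<exists>v::'i \<Rightarrow> complex. (\<exists>a. v a \<noteq> 0) \<and>
       (\<forall>a. (\<Sum>b\<in>UNIV. complex_of_real (A a b) * v b) = c * v a)}"

text \<open>theta * H^{W_s}_{1-theta}(M) = log lambda(W_s^{1-theta}); H at theta = 0 is the limit.\<close>
definition H_src :: "('m::finite \<Rightarrow> 'm \<Rightarrow> real) \<Rightarrow> real \<Rightarrow> real" where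
  "H_src Ws \<theta> = (if \<theta> = 0
      then Lim (at 0) (\<lambda>t. (1 / t) * ln (pf_eig (\<lambda>m m'. Ws m m' powr (1 - t))))
      else (1 / \<theta>) * ln (pf_eig (\<lambda>m m'. Ws m m' powr (1 - \<theta>))))"

text \<open>Marginal W_{c,Z}(z|z') = sum_x W_c(x,z|x',z'), evaluated at x' = 0
  (independent of x' under Assumption 2).\<close>
definition WcZ :: "('x::{finite,zero} \<times> 'z::finite \<Rightarrow> 'x \<times> 'z \<Rightarrow> real) \<Rightarrow> 'z \<Rightarrow> 'z \<Rightarrow> real" where
  "WcZ Wc z z' = (\<Sum>x\<in>UNIV. Wc (x, z) (0, z'))"

definition admissible_V :: "('x::{finite,zero} \<times> 'z::finite \<Rightarrow> 'x \<times> 'z \<Rightarrow> real) \<Rightarrow> ('z \<Rightarrow> 'z \<Rightarrow> real) \<Rightarrow> bool" where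
  "admissible_V Wc V \<longleftrightarrow> transition_matrix V \<and> (\<forall>z z'. WcZ Wc z z' > 0 \<longrightarrow> V z z' > 0)"

text \<open>H^{W_c|V}_{1-theta}(X|Z) for theta \<noteq> 0.\<close>
definition H_cond_V :: "('x::{finite,zero} \<times> 'z::finite \<Rightarrow> 'x \<times> 'z \<Rightarrow> real) \<Rightarrow> ('z \<Rightarrow> 'z \<Rightarrow> real) \<Rightarrow> real \<Rightarrow> real" where
  "H_cond_V Wc V \<theta> = (1 / \<theta>) * ln (pf_eig (\<lambda>(x, z) (x', z').
       Wc (x, z) (x', z') powr (1 - \<theta>) * V z z' powr \<theta>))"

definition H_up :: "('x::{finite,zero} \<times> 'z::finite \<Rightarrow> 'x \<times> 'z \<Rightarrow> real) \<Rightarrow> real \<Rightarrow> real" where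
  "H_up Wc \<theta> = (SUP V\<in>{V. admissible_V Wc V}. H_cond_V Wc V \<theta>)"

definition H_down :: "('x::{finite,zero} \<times> 'z::finite \<Rightarrow> 'x \<times> 'z \<Rightarrow> real) \<Rightarrow> real \<Rightarrow> real" where
  "H_down Wc \<theta> = H_cond_V Wc (WcZ Wc) \<theta>"

definition H_cond :: "('x::{finite,zero} \<times> 'z::finite \<Rightarrow> 'x \<times> 'z \<Rightarrow> real) \<Rightarrow> real" where
  "H_cond Wc = Lim (at 0) (H_down Wc)"

definition U_up :: "('m::finite \<Rightarrow> 'm \<Rightarrow> real) \<Rightarrow> ('x::{finite,zero} \<times> 'z::finite \<Rightarrow> 'x \<times> 'z \<Rightarrow> real) \<Rightarrow> real \<Rightarrow> real \<Rightarrow> real" where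
  "U_up Ws Wc r \<theta> = r * \<theta> * H_src Ws \<theta> + \<theta> * H_up Wc \<theta>"

definition assumption2 :: "('x::{finite,zero} \<times> 'z::finite \<Rightarrow> 'x \<times> 'z \<Rightarrow> real) \<Rightarrow> bool" where
  "assumption2 Wc \<longleftrightarrow>
     (\<forall>\<theta><1. \<forall>z z' x1 x2. (\<Sum>x\<in>UNIV. Wc (x, z) (x1, z') powr (1 - \<theta>))
                           = (\<Sum>x\<in>UNIV. Wc (x, z) (x2, z') powr (1 - \<theta>)))
     \<or> CARD('z) = 1"

fun mc_tail :: "('a \<Rightarrow> 'a \<Rightarrow> real) \<Rightarrow> 'a \<Rightarrow> 'a list \<Rightarrow> real" where
  "mc_tail W prev [] = 1"
| "mc_tail W prev (a # as) = W a prev * mc_tail W a as"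

fun mc_prob :: "('a \<Rightarrow> real) \<Rightarrow> ('a \<Rightarrow> 'a \<Rightarrow> real) \<Rightarrow> 'a list \<Rightarrow> real" where
  "mc_prob P1 W [] = 1"
| "mc_prob P1 W (a # as) = P1 a * mc_tail W a as"

text \<open>Average decoding error of the code (e, d) for block lengths k, n.
  Output (y^n, z^n) given input xt^n has probability P_{X^nZ^n}(y^n - xt^n, z^n).\<close>
definition avg_err ::
  "('m::finite \<Rightarrow> real) \<Rightarrow> ('m \<Rightarrow> 'm \<Rightarrow> real) \<Rightarrow>
   ('x::{finite,ab_group_add} \<times> 'z::finite \<Rightarrow> real) \<Rightarrow> ('x \<times> 'z \<Rightarrow> 'x \<times> 'z \<Rightarrow> real) \<Rightarrow>
   nat \<Rightarrow> nat \<Rightarrow> ('m list \<Rightarrow> 'x list) \<Rightarrow> (('x \<times> 'z) list \<Rightarrow> 'm list) \<Rightarrow> real" where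
  "avg_err PM1 Ws PXZ1 Wc k n e d =
     (\<Sum>ms\<in>{ms. length ms = k}. mc_prob PM1 Ws ms *
        (\<Sum>ys\<in>{ys. length ys = n}.
           (if d ys \<noteq> ms then
              mc_prob PXZ1 Wc (map2 (\<lambda>(y, z) xt. (y - xt, z)) ys (e ms)) else 0)))"

definition Pj ::
  "('m::finite \<Rightarrow> real) \<Rightarrow> ('m \<Rightarrow> 'm \<Rightarrow> real) \<Rightarrow>
   ('x::{finite,ab_group_add} \<times> 'z::finite \<Rightarrow> real) \<Rightarrow> ('x \<times> 'z \<Rightarrow> 'x \<times> 'z \<Rightarrow> real) \<Rightarrow>
   nat \<Rightarrow> nat \<Rightarrow> real" where
  "Pj PM1 Ws PXZ1 Wc k n =
     Inf {avg_err PM1 Ws PXZ1 Wc k n e d | e d. \<forall>ms. length ms = k \<longrightarrow> length (e ms) = n}"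

definition neg_log_rate :: "nat \<Rightarrow> real \<Rightarrow> ereal" where
  "neg_log_rate n p = (if p = 0 then \<infinity> else ereal (- (1 / real n) * ln p))"

end

theory Submission
  imports Defs
begin

text \<open>Weight a message path \<open>m\<close> and a noise path \<open>(x, z)\<close> by
  \<open>T_\<theta> = (P(m) P(x, z)) powr (1 - \<theta>) * V(z) powr \<theta>\<close> for a Markov chain \<open>V\<close> on the side information.
  Up to constants these weights sum to \<open>exp (n * F \<theta>)\<close>, where \<open>F\<close> is a logarithm of Perron--Frobenius
  eigenvalues, \<open>F \<le> U\<close>, and \<open>U\<close> is the supremum of \<open>F\<close> over \<open>V\<close>. On the set of correct decodings,
  \<open>V\<close> sums to at most \<open>CARD('x) ^ n\<close>, so interpolating \<open>T_\<theta>\<close> there between some \<open>T_\<theta>1\<close> with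
  \<open>\<theta>1 < \<theta>\<close> and \<open>V\<close> by Hoelder shows that for \<open>\<theta> > \<theta>0\<close> the decoding errors carry most
  of the weight \<open>T_\<theta>\<close>. Interpolating \<open>T_\<theta>\<close> on the errors between \<open>P = T_0\<close> and some \<open>T_\<theta>2\<close> with
  \<open>\<theta>2 > \<theta>\<close> then bounds the error probability from below, and letting the parameters merge gives
  the exponent \<open>\<theta> * U' - U\<close>. The equality with the supremum is the tangent inequality for the convex
  function \<open>U\<close>. Assumption 2 serves to make \<open>U\<close> differentiable: it identifies the supremum over \<open>V\<close>
  with a single Perron--Frobenius eigenvalue.\<close>

subsection \<open>Perron--Frobenius theory\<close>

text \<open>Every parameter can be read off the graph of \<open>U\<close>. The equation for
  \<theta>0 says that the tangent at \<theta>0 passes through the point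
  \<open>(1, ln CARD('x))\<close>, and the claimed exponent is minus the value of this tangent at 0.
  Each Hoelder step is a chord: \<open>U\<close> must exceed at \<theta> the chord from \<theta>1 to
  that point for correct decoding to be negligible, and the chord through \<theta> and \<theta>2,
  evaluated at 0, is minus the exponent obtained. Merging the parameters turns both chords into the
  tangent.

  Hoelder compares the same weights at different exponents, so \<open>V\<close> has to stay fixed
  although the best \<open>V\<close> moves with \<theta>. It suffices that \<open>V\<close> is
  nearly optimal at the middle parameter \<theta>, because at \<theta>1 and \<theta>2 only the bound
  F \<le> U is used. Hoelder also replaces type counting and large deviations: path sums enter only
  up to constant factors, and positive Perron vectors provide these.

  If \<open>U\<close> is affine just above \<theta>0, no gap opens there; the parameters then have
  to start at the end of the affine piece.\<close>

text \<open>Irreducibility in terms of closed sets is invariant under transposition, which passes to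
  complements, so every result on right eigenvectors has a left version.\<close>
definition irreducible_nonneg :: "('i \<Rightarrow> 'i \<Rightarrow> real) \<Rightarrow> bool" where
  "irreducible_nonneg A \<longleftrightarrow> (\<forall>a b. 0 \<le> A a b) \<and> (\<exists>a b. 0 < A a b) \<and>
     (\<forall>S. S \<noteq> {} \<longrightarrow> (\<forall>a b. b \<in> S \<longrightarrow> 0 < A a b \<longrightarrow> a \<in> S) \<longrightarrow> S = UNIV)"

lemma irreducible_nonneg_nonneg: "irreducible_nonneg A \<Longrightarrow> 0 \<le> A a b"
  by (simp add: irreducible_nonneg_def)

lemma irreducible_nonneg_closed:
  assumes "irreducible_nonneg A" "b0 \<in> S" "\<And>a b. b \<in> S \<Longrightarrow> 0 < A a b \<Longrightarrow> a \<in> S"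
  shows "a \<in> S"
proof -
  have "S \<noteq> {}" "\<forall>a b. b \<in> S \<longrightarrow> 0 < A a b \<longrightarrow> a \<in> S"
    using assms(2,3) by auto
  then have "S = UNIV"
    using assms(1) unfolding irreducible_nonneg_def by blast
  then show ?thesis by simp
qed

lemma irreducible_nonneg_mono:
  assumes "irreducible_nonneg A" "\<And>a b. 0 \<le> B a b" "\<And>a b. 0 < A a b \<Longrightarrow> 0 < B a b"
  shows "irreducible_nonneg B"
  using assms unfolding irreducible_nonneg_def by meson

lemma irreducible_nonneg_transpose:
  assumes "irreducible_nonneg A"
  shows "irreducible_nonneg (\<lambda>a b. A b a)"
  unfolding irreducible_nonneg_def
proof (intro conjI allI impI)
  fix S :: "'a set"
  assume S: "S \<noteq> {}" "\<forall>a b. b \<in> S \<longrightarrow> 0 < A b a \<longrightarrow> a \<in> S"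
  show "S = UNIV"
  proof (rule ccontr)
    assume "S \<noteq> UNIV"
    then obtain c where c: "c \<in> - S" by blast
    obtain d where d: "d \<in> S" using S(1) by blast
    have "d \<in> - S"
      by (rule irreducible_nonneg_closed[OF assms c]) (use S(2) in auto)
    then show False using d by simp
  qed
qed (use assms in \<open>auto simp: irreducible_nonneg_def\<close>)

text \<open>A positive entry of \<open>matpow W k\<close> comes from a path of positive entries, and
  no such path leaves a closed set. By irreducibility the paths starting in a nonempty closed set
  reach every state.\<close>

lemma irreducible_nonneg_irreducible_mat:
  fixes W :: "'i::finite \<Rightarrow> 'i \<Rightarrow> real"
  assumes "\<And>a b. 0 \<le> W a b" "irreducible_mat W"
  shows "irreducible_nonneg W"
  unfolding irreducible_nonneg_def
proof (intro conjI allI impI)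
  have nn: "0 \<le> matpow W k a b" for k a b
    by (induction k arbitrary: a b) (auto intro!: sum_nonneg mult_nonneg_nonneg assms(1))
  have step: "\<exists>c. 0 < W a c \<and> 0 < matpow W k c b" if "0 < matpow W (Suc k) a b" for k a b
  proof (rule ccontr)
    assume "\<not> ?thesis"
    then have "W a c * matpow W k c b = 0" for c
      using assms(1)[of a c] nn[of k c b] by (metis less_eq_real_def mult_eq_0_iff)
    then have "(\<Sum>c\<in>UNIV. W a c * matpow W k c b) = 0" by (intro sum.neutral) simp
    then show False using that by simp
  qed
  fix a b
  obtain k where "k > 0" "0 < matpow W k a b"
    using assms(2) unfolding irreducible_mat_def by blast
  then show "\<exists>a b. 0 < W a b"
    using step[of "k - 1" a b] by auto
  fix S :: "'i set"
  assume S: "S \<noteq> {}" "\<forall>a b. b \<in> S \<longrightarrow> 0 < W a b \<longrightarrow> a \<in> S"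
  have closed: "a \<in> S" if "b \<in> S" "0 < matpow W k a b" for k a b
    using that
  proof (induction k arbitrary: a)
    case 0
    then show ?case by (auto split: if_splits)
  next
    case (Suc k)
    then show ?case using step[of k a b] S(2) by blast
  qed
  show "S = UNIV"
    using closed S(1) assms(2) unfolding irreducible_mat_def by blast
qed (rule assms(1))

text \<open>The support of \<open>v\<close> is closed: one positive term in a row sum forces
  \<open>l * v a\<close> to be nonzero. The sign of \<open>l\<close> stays open, as it is unknown
  for the fixed point delivered by Brouwer.\<close>

lemma irreducible_nonneg_eigvec_pos:
  fixes A :: "'i::finite \<Rightarrow> 'i \<Rightarrow> real"
  assumes A: "irreducible_nonneg A" and v: "\<And>a. 0 \<le> v a" "0 < v a0"
    and ev: "\<And>a. (\<Sum>b\<in>UNIV. A a b * v b) = l * v a"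
  shows "0 < v a"
proof -
  have "a \<in> {b. 0 < v b}"
  proof (rule irreducible_nonneg_closed[OF A])
    show "a0 \<in> {b. 0 < v b}" using v(2) by simp
    fix a b assume "b \<in> {b. 0 < v b}" "0 < A a b"
    then have "0 < A a b * v b" by simp
    also have "\<dots> \<le> (\<Sum>b\<in>UNIV. A a b * v b)"
      by (intro member_le_sum) (auto intro!: mult_nonneg_nonneg v irreducible_nonneg_nonneg[OF A])
    finally have "v a \<noteq> 0" using ev[of a] by auto
    then show "a \<in> {b. 0 < v b}" using v(1)[of a] by simp
  qed
  then show ?thesis by simp
qed

lemma irreducible_nonneg_eigval_pos:
  fixes A :: "'i::finite \<Rightarrow> 'i \<Rightarrow> real"
  assumes A: "irreducible_nonneg A" and v: "\<And>a. 0 < v a"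
    and ev: "\<And>a. (\<Sum>b\<in>UNIV. A a b * v b) = l * v a"
  shows "0 < l"
proof -
  obtain a b where "0 < A a b" using A by (auto simp: irreducible_nonneg_def)
  then have "0 < A a b * v b" using v by simp
  also have "\<dots> \<le> (\<Sum>b\<in>UNIV. A a b * v b)"
    using less_imp_le[OF v]
    by (intro member_le_sum) (auto intro!: mult_nonneg_nonneg irreducible_nonneg_nonneg[OF A])
  finally show ?thesis using ev[of a] v[of a] by (simp add: zero_less_mult_iff)
qed

definition simplex_set :: "(real^'i::finite) set" where
  "simplex_set = {x. (\<forall>i. 0 \<le> x $ i) \<and> (\<Sum>i\<in>UNIV. x $ i) = 1}"

lemma compact_simplex_set: "compact simplex_set"
proof -
  have "closed (simplex_set :: (real^'i) set)"
  proof -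
    have eq: "simplex_set = (\<Inter>i. {x::real^'i. 0 \<le> x $ i}) \<inter> {x. (\<Sum>i\<in>UNIV. x $ i) = 1}"
      by (auto simp: simplex_set_def)
    moreover have "closed {x::real^'i. 0 \<le> x $ i}" for i
      by (intro closed_Collect_le continuous_intros)
    moreover have "closed {x::real^'i. (\<Sum>i\<in>UNIV. x $ i) = 1}"
      by (intro closed_Collect_eq continuous_intros)
    ultimately show ?thesis unfolding eq by (intro closed_Int closed_INT) blast+
  qed
  moreover have "bounded (simplex_set :: (real^'i) set)"
  proof (rule boundedI)
    fix x :: "real^'i" assume "x \<in> simplex_set"
    then show "norm x \<le> 1"
      using norm_le_l1_cart[of x] by (simp add: simplex_set_def)
  qed
  ultimately show ?thesis by (simp add: compact_eq_bounded_closed)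
qed

lemma convex_simplex_set: "convex simplex_set"
  by (auto simp: convex_def simplex_set_def sum.distrib simp flip: sum_distrib_left)

text \<open>Brouwer is applied to \<open>x \<mapsto> x + A x\<close> (normalised) rather than \<open>A x\<close>,
  since \<open>x + A x\<close> never vanishes on the simplex.\<close>
lemma Perron_Frobenius_simplex:
  fixes A :: "'i::finite \<Rightarrow> 'i \<Rightarrow> real"
  assumes A: "irreducible_nonneg A"
  shows "\<exists>v\<in>simplex_set. (\<forall>a. 0 < v $ a) \<and> (\<exists>l>0. \<forall>a. (\<Sum>b\<in>UNIV. A a b * v $ b) = l * v $ a)"
proof -
  define g :: "real^'i \<Rightarrow> real^'i" where "g x = (\<chi> a. x $ a + (\<Sum>b\<in>UNIV. A a b * x $ b))" for x
  define s where "s x = (\<Sum>a\<in>UNIV. g x $ a)" for x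
  have g_nn: "0 \<le> g x $ a" and s_ge: "1 \<le> s x" if "x \<in> simplex_set" for x a
  proof -
    have nn: "0 \<le> (\<Sum>b\<in>UNIV. A a b * x $ b)" for a
      using that by (auto intro!: sum_nonneg mult_nonneg_nonneg irreducible_nonneg_nonneg[OF A] simp: simplex_set_def)
    then show "0 \<le> g x $ a" using that by (simp add: g_def simplex_set_def)
    show "1 \<le> s x" using that nn
      by (simp add: s_def g_def sum.distrib simplex_set_def sum_nonneg)
  qed
  have cg: "continuous_on simplex_set (\<lambda>x. g x $ a)" for a
    unfolding g_def by (auto intro!: continuous_intros)
  obtain v where v: "v \<in> simplex_set" "(1 / s v) *\<^sub>R g v = v"
  proof (rule brouwer[OF compact_simplex_set convex_simplex_set])
    have "axis undefined 1 \<in> (simplex_set :: (real^'i) set)"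
      by (simp add: simplex_set_def axis_def)
    then show "simplex_set \<noteq> ({} :: (real^'i) set)" by blast
    have cs: "continuous_on simplex_set s"
      unfolding s_def by (intro continuous_intros cg)
    have "continuous_on simplex_set (\<lambda>x. \<chi> a. g x $ a)"
      by (intro continuous_on_vec_lambda cg)
    then have "continuous_on simplex_set g" by simp
    then show "continuous_on simplex_set (\<lambda>x. (1 / s x) *\<^sub>R g x)"
      using s_ge by (intro continuous_intros cs) force
    show "(\<lambda>x. (1 / s x) *\<^sub>R g x) \<in> simplex_set \<rightarrow> simplex_set"
    proof
      fix x :: "real^'i" assume x: "x \<in> simplex_set"
      have "(\<Sum>a\<in>UNIV. 1 / s x * g x $ a) = 1 / s x * s x"
        by (simp only: s_def sum_distrib_left)
      also have "\<dots> = 1" using s_ge[OF x] by simp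
      finally show "(1 / s x) *\<^sub>R g x \<in> simplex_set"
        using g_nn[OF x] s_ge[OF x] by (simp add: simplex_set_def)
    qed
  qed auto
  have nn: "0 \<le> v $ a" for a using v(1) by (simp add: simplex_set_def)
  have ev: "(\<Sum>b\<in>UNIV. A a b * v $ b) = (s v - 1) * v $ a" for a
  proof -
    have "1 / s v * g v $ a = v $ a"
      using v(2) by (metis vector_scaleR_component real_scaleR_def)
    then have "g v $ a = s v * v $ a" using s_ge[OF v(1)] by (auto simp: field_simps)
    then show ?thesis by (simp add: g_def algebra_simps)
  qed
  obtain a0 where "0 < v $ a0"
  proof -
    have "(\<Sum>a\<in>UNIV. v $ a) \<noteq> 0" using v(1) by (simp add: simplex_set_def)
    then obtain a where "v $ a \<noteq> 0" by (meson sum.neutral)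
    then have "0 < v $ a" using nn[of a] by simp
    then show ?thesis by (rule that)
  qed
  then have pos: "0 < v $ a" for a
    using irreducible_nonneg_eigvec_pos[OF A nn _ ev] by blast
  show ?thesis
    using v(1) pos ev irreducible_nonneg_eigval_pos[OF A pos ev] by blast
qed

lemma Perron_Frobenius:
  fixes A :: "'i::finite \<Rightarrow> 'i \<Rightarrow> real"
  assumes "irreducible_nonneg A"
  obtains l v where "0 < l" "\<And>a. 0 < v a" "\<And>a. (\<Sum>b\<in>UNIV. A a b * v b) = l * v a"
  using Perron_Frobenius_simplex[OF assms] by metis

lemma Perron_Frobenius_left:
  fixes A :: "'i::finite \<Rightarrow> 'i \<Rightarrow> real"
  assumes "irreducible_nonneg A"
  obtains l u where "0 < l" "\<And>a. 0 < u a" "\<And>b. (\<Sum>a\<in>UNIV. u a * A a b) = l * u b"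
  using Perron_Frobenius[OF irreducible_nonneg_transpose[OF assms]]
  by (metis (no_types, lifting) mult.commute sum.cong)

text \<open>Maximum principle: at the index where \<open>cmod (w a) / v a\<close> is largest, the
  triangle inequality in the eigenvalue equation of \<open>w\<close> is compared with the inequality
  for \<open>v\<close>.\<close>

lemma eigval_bounded_right:
  fixes A :: "'i::finite \<Rightarrow> 'i \<Rightarrow> real" and w :: "'i \<Rightarrow> complex"
  assumes A: "\<And>a b. 0 \<le> A a b" and v: "\<And>a. 0 < v a"
    and ev: "\<And>a. (\<Sum>b\<in>UNIV. A a b * v b) \<le> l * v a"
    and w: "w a0 \<noteq> 0" "\<And>a. (\<Sum>b\<in>UNIV. complex_of_real (A a b) * w b) = c * w a"
  shows "cmod c \<le> l"
proof -
  define m where "m = Max (range (\<lambda>a. cmod (w a) / v a))"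
  have le: "cmod (w b) \<le> m * v b" for b
  proof -
    have "cmod (w b) / v b \<le> m" unfolding m_def by (intro Max_ge) auto
    then show ?thesis using v[of b] by (simp add: divide_le_eq)
  qed
  have "m \<in> range (\<lambda>a. cmod (w a) / v a)" unfolding m_def by (intro Max_in) auto
  then obtain a where "m = cmod (w a) / v a" by blast
  then have a: "cmod (w a) = m * v a" using v[of a] by simp
  have m: "0 < m"
  proof -
    have "0 < m * v a0" using le[of a0] w(1) by (meson order_less_le_trans zero_less_norm_iff)
    then show ?thesis using v[of a0] by (simp add: zero_less_mult_iff)
  qed
  have "cmod c * (m * v a) = cmod (\<Sum>b\<in>UNIV. complex_of_real (A a b) * w b)"
    by (simp only: w(2) norm_mult a)
  also have "\<dots> \<le> (\<Sum>b\<in>UNIV. cmod (complex_of_real (A a b) * w b))"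
    by (rule norm_sum)
  also have "\<dots> \<le> (\<Sum>b\<in>UNIV. A a b * (m * v b))"
    by (intro sum_mono) (simp add: norm_mult A le mult_left_mono)
  also have "\<dots> = m * (\<Sum>b\<in>UNIV. A a b * v b)"
    by (simp add: sum_distrib_left mult_ac)
  also have "\<dots> \<le> m * (l * v a)"
    using m ev by (intro mult_left_mono) auto
  finally have "cmod c * (m * v a) \<le> l * (m * v a)" by (simp add: mult_ac)
  then show ?thesis using m v[of a] by simp
qed

text \<open>\<open>pf_eig\<close> is a \<open>Max\<close>, which is informative only on a finite
  set. The eigenvalues are the roots of the characteristic polynomial, and this is not the zero
  polynomial because \<open>\<bar>l\<bar> + 1\<close> lies beyond the bound on eigenvalues.\<close>

lemma finite_eigvals:
  fixes A :: "'i::finite \<Rightarrow> 'i \<Rightarrow> real"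
  assumes bound: "\<And>c (w::'i \<Rightarrow> complex) a0. w a0 \<noteq> 0 \<Longrightarrow>
      (\<And>a. (\<Sum>b\<in>UNIV. complex_of_real (A a b) * w b) = c * w a) \<Longrightarrow> cmod c \<le> l"
  shows "finite {c. \<exists>w::'i \<Rightarrow> complex. (\<exists>a. w a \<noteq> 0) \<and>
           (\<forall>a. (\<Sum>b\<in>UNIV. complex_of_real (A a b) * w b) = c * w a)}" (is "finite ?E")
proof -
  define M :: "complex \<Rightarrow> complex^'i^'i" where
    "M c = (\<chi> a b. complex_of_real (A a b) - (if a = b then c else 0))" for c
  define P :: "complex poly^'i^'i" where
    "P = (\<chi> a b. [:complex_of_real (A a b):] - (if a = b then [:0, 1:] else 0))"
  have poly_P: "poly (det P) c = det (M c)" for c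
    unfolding det_def P_def M_def
    by (auto simp: poly_sum poly_prod intro!: sum.cong prod.cong)
  have Mv: "M c *v x = 0 \<longleftrightarrow> (\<forall>a. (\<Sum>b\<in>UNIV. complex_of_real (A a b) * x $ b) = c * x $ a)" for c x
  proof -
    have "(\<Sum>b\<in>UNIV. (if a = b then c else 0) * x $ b) = c * x $ a" for a
    proof -
      have "(\<Sum>b\<in>UNIV. (if a = b then c else 0) * x $ b) = (\<Sum>b\<in>UNIV. if a = b then c * x $ b else 0)"
        by (intro sum.cong) auto
      then show ?thesis by simp
    qed
    then show ?thesis
      by (simp add: vec_eq_iff matrix_vector_mult_def M_def left_diff_distrib sum_subtractf)
  qed
  have det0: "det (M c) = 0 \<longleftrightarrow> c \<in> ?E" for c
  proof -
    have "det (M c) = 0 \<longleftrightarrow> (\<exists>x. M c *v x = 0 \<and> x \<noteq> 0)"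
      using invertible_det_nz[of "M c"] invertible_left_inverse[of "M c"] matrix_left_invertible_ker[of "M c"]
      by auto
    also have "\<dots> \<longleftrightarrow> c \<in> ?E"
    proof
      assume "\<exists>x. M c *v x = 0 \<and> x \<noteq> 0"
      then obtain x where "M c *v x = 0" "x \<noteq> 0" by blast
      then show "c \<in> ?E"
        unfolding Mv by (intro CollectI exI[of _ "\<lambda>a. x $ a"]) (simp add: vec_eq_iff)
    next
      assume "c \<in> ?E"
      then obtain w a where w: "w a \<noteq> 0"
        "\<forall>a. (\<Sum>b\<in>UNIV. complex_of_real (A a b) * w b) = c * w a" by blast
      then show "\<exists>x. M c *v x = 0 \<and> x \<noteq> 0"
          by (intro exI[of _ "\<chi> a. w a"]) (simp only: Mv, auto simp: vec_eq_iff)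
    qed
    finally show ?thesis .
  qed
  have "complex_of_real (\<bar>l\<bar> + 1) \<notin> ?E"
  proof
    assume "complex_of_real (\<bar>l\<bar> + 1) \<in> ?E"
    then obtain w a0 where "w a0 \<noteq> 0"
      "\<And>a. (\<Sum>b\<in>UNIV. complex_of_real (A a b) * w b) = complex_of_real (\<bar>l\<bar> + 1) * w a"
      by auto
    then have "cmod (complex_of_real (\<bar>l\<bar> + 1)) \<le> l" by (rule bound)
    then show False unfolding norm_of_real by linarith
  qed
  then have "poly (det P) (complex_of_real (\<bar>l\<bar> + 1)) \<noteq> 0" unfolding poly_P det0 .
  then have "det P \<noteq> 0" by auto
  then have "finite {c. poly (det P) c = 0}" by (rule poly_roots_finite)
  then show ?thesis by (simp only: poly_P det0 Collect_mem_eq)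
qed

text \<open>The eigenvalue of a positive eigenvector dominates all eigenvalue moduli and is itself
  one of them. This is the only access to the definition of \<open>pf_eig\<close>; everything later
  goes through positive eigenvectors.\<close>

lemma pf_eig_eqI:
  fixes A :: "'i::finite \<Rightarrow> 'i \<Rightarrow> real"
  assumes A: "\<And>a b. 0 \<le> A a b" and v: "\<And>a. 0 < v a"
    and ev: "\<And>a. (\<Sum>b\<in>UNIV. A a b * v b) = l * v a"
  shows "pf_eig A = l"
proof -
  let ?E = "{c. \<exists>w::'i \<Rightarrow> complex. (\<exists>a. w a \<noteq> 0) \<and>
           (\<forall>a. (\<Sum>b\<in>UNIV. complex_of_real (A a b) * w b) = c * w a)}"
  have bound: "cmod c \<le> l" if "w a0 \<noteq> 0"
    "\<And>a. (\<Sum>b\<in>UNIV. complex_of_real (A a b) * w b) = c * w a" for c w a0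
    by (rule eigval_bounded_right[where v = v and A = A and w = w]) (use A v ev that in auto)
  have "pf_eig A = Max (cmod ` ?E)"
    unfolding pf_eig_def by (rule arg_cong[of _ _ Max]) blast
  also have "\<dots> = l"
  proof (rule Max_eqI)
    show "finite (cmod ` ?E)"
    proof (rule finite_imageI, rule finite_eigvals[where l = l])
      show "cmod c \<le> l" if "w a0 \<noteq> 0"
        "\<And>a. (\<Sum>b\<in>UNIV. complex_of_real (A a b) * w b) = c * w a" for c w a0
        using that by (rule bound)
    qed
    show "y \<le> l" if y: "y \<in> cmod ` ?E" for y
    proof -
      obtain c where c: "y = cmod c" "c \<in> ?E" using y by (rule imageE)
      from c(2) obtain w where w: "(\<exists>a. w a \<noteq> 0) \<and>
        (\<forall>a. (\<Sum>b\<in>UNIV. complex_of_real (A a b) * w b) = c * w a)"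
        unfolding mem_Collect_eq by (rule exE)
      from w obtain a0 where "w a0 \<noteq> 0" by blast
      then have "cmod c \<le> l" by (rule bound) (rule spec[OF conjunct2[OF w]])
      then show ?thesis using c(1) by simp
    qed
    have "0 \<le> l * v undefined"
      unfolding ev[symmetric] by (intro sum_nonneg mult_nonneg_nonneg A less_imp_le[OF v])
    then have l: "0 \<le> l" using v[of undefined] by (simp add: zero_le_mult_iff)
    have "complex_of_real l \<in> ?E"
    proof (intro CollectI exI conjI allI)
      show "complex_of_real (v undefined) \<noteq> 0" using v[of undefined] by simp
      fix a
      show "(\<Sum>b\<in>UNIV. complex_of_real (A a b) * complex_of_real (v b))
          = complex_of_real l * complex_of_real (v a)"
        by (simp only: ev flip: of_real_mult of_real_sum)
    qed
    then show "l \<in> cmod ` ?E"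
      by (rule rev_image_eqI) (simp add: l)
  qed
  finally show ?thesis .
qed

lemma pf_eig_right:
  fixes A :: "'i::finite \<Rightarrow> 'i \<Rightarrow> real"
  assumes A: "irreducible_nonneg A"
  obtains v where "\<And>a. 0 < v a" "\<And>a. (\<Sum>b\<in>UNIV. A a b * v b) = pf_eig A * v a"
proof -
  obtain l v where "0 < l" and v: "\<And>a. 0 < v a" "\<And>a. (\<Sum>b\<in>UNIV. A a b * v b) = l * v a"
    using Perron_Frobenius[OF A] by metis
  have "pf_eig A = l"
    by (rule pf_eig_eqI[where v = v]) (use v irreducible_nonneg_nonneg[OF A] in auto)
  then show ?thesis using v by (intro that[of v]) auto
qed

lemma pf_eig_pos:
  fixes A :: "'i::finite \<Rightarrow> 'i \<Rightarrow> real"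
  assumes A: "irreducible_nonneg A"
  shows "0 < pf_eig A"
proof -
  obtain v where v: "\<And>a. 0 < v a" "\<And>a. (\<Sum>b\<in>UNIV. A a b * v b) = pf_eig A * v a"
    using pf_eig_right[OF A] by metis
  then show ?thesis by (rule irreducible_nonneg_eigval_pos[OF A])
qed

text \<open>Testing a relation for \<open>A x\<close> against a left eigenvector replaces the matrix
  by a number. This carries the comparison of left and right eigenvalues, the bound for subinvariant
  vectors and the derivative of \<open>pf_eig\<close>.\<close>

lemma bilinear_pairing:
  fixes A :: "'i::finite \<Rightarrow> 'i \<Rightarrow> real"
  assumes "\<And>b. (\<Sum>a\<in>UNIV. u a * A a b) = l * u b"
  shows "(\<Sum>a\<in>UNIV. u a * (\<Sum>b\<in>UNIV. A a b * x b)) = l * (\<Sum>a\<in>UNIV. u a * x a)"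
proof -
  have "(\<Sum>a\<in>UNIV. u a * (\<Sum>b\<in>UNIV. A a b * x b)) = (\<Sum>a\<in>UNIV. \<Sum>b\<in>UNIV. u a * A a b * x b)"
    by (simp add: sum_distrib_left mult.assoc)
  also have "\<dots> = (\<Sum>b\<in>UNIV. \<Sum>a\<in>UNIV. u a * A a b * x b)"
    by (rule sum.swap)
  also have "\<dots> = (\<Sum>b\<in>UNIV. (\<Sum>a\<in>UNIV. u a * A a b) * x b)"
    by (simp add: sum_distrib_right)
  finally show ?thesis by (simp add: assms sum_distrib_left mult.assoc)
qed

lemma pf_eig_eqI_left:
  fixes A :: "'i::finite \<Rightarrow> 'i \<Rightarrow> real"
  assumes A: "irreducible_nonneg A" and u: "\<And>a. 0 < u a"
    and ev: "\<And>b. (\<Sum>a\<in>UNIV. u a * A a b) = l * u b"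
  shows "pf_eig A = l"
proof -
  obtain v where v: "\<And>a. 0 < v a" "\<And>a. (\<Sum>b\<in>UNIV. A a b * v b) = pf_eig A * v a"
    using pf_eig_right[OF A] by metis
  have "pf_eig A * (\<Sum>a\<in>UNIV. u a * v a) = l * (\<Sum>a\<in>UNIV. u a * v a)"
    using bilinear_pairing[where A = A and u = u and l = l and x = v, OF ev] unfolding v(2)
    by (simp add: sum_distrib_left mult_ac)
  moreover have "0 < (\<Sum>a\<in>UNIV. u a * v a)"
    by (intro sum_pos) (auto simp: u v)
  ultimately show ?thesis by simp
qed

lemma pf_eig_left:
  fixes A :: "'i::finite \<Rightarrow> 'i \<Rightarrow> real"
  assumes A: "irreducible_nonneg A"
  obtains u where "\<And>a. 0 < u a" "\<And>b. (\<Sum>a\<in>UNIV. u a * A a b) = pf_eig A * u b"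
proof -
  obtain l u where "0 < l" and u: "\<And>a. 0 < u a" "\<And>b. (\<Sum>a\<in>UNIV. u a * A a b) = l * u b"
    using Perron_Frobenius_left[OF A] by metis
  have "pf_eig A = l"
    by (rule pf_eig_eqI_left[OF A, where u = u]) (use u in auto)
  then show ?thesis using u by (intro that[of u]) auto
qed

text \<open>The Collatz--Wielandt upper bound, from pairing the inequality with the positive left
  Perron vector.\<close>

lemma pf_eig_le:
  fixes A :: "'i::finite \<Rightarrow> 'i \<Rightarrow> real"
  assumes A: "irreducible_nonneg A" and x: "\<And>a. 0 < x a"
    and le: "\<And>a. (\<Sum>b\<in>UNIV. A a b * x b) \<le> c * x a"
  shows "pf_eig A \<le> c"
proof -
  obtain u where u: "\<And>a. 0 < u a" "\<And>b. (\<Sum>a\<in>UNIV. u a * A a b) = pf_eig A * u b"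
    using pf_eig_left[OF A] by metis
  have "pf_eig A * (\<Sum>a\<in>UNIV. u a * x a) \<le> c * (\<Sum>a\<in>UNIV. u a * x a)"
  proof -
    have "(\<Sum>a\<in>UNIV. u a * (\<Sum>b\<in>UNIV. A a b * x b)) \<le> (\<Sum>a\<in>UNIV. u a * (c * x a))"
      by (intro sum_mono mult_left_mono le less_imp_le[OF u(1)])
    then show ?thesis
      unfolding bilinear_pairing[where A = A and u = u and x = x, OF u(2)]
      by (simp add: sum_distrib_left mult_ac)
  qed
  moreover have "0 < (\<Sum>a\<in>UNIV. u a * x a)"
    by (intro sum_pos) (auto simp: u x)
  ultimately show ?thesis by simp
qed

lemma pf_eig_stochastic:
  fixes V :: "'i::finite \<Rightarrow> 'i \<Rightarrow> real"
  assumes "irreducible_nonneg V" "transition_matrix V"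
  shows "pf_eig V = 1"
  by (rule pf_eig_eqI_left[OF assms(1), where u = "\<lambda>_. 1"])
    (use assms(2) in \<open>simp_all add: transition_matrix_def\<close>)

section \<open>Log-convexity and differentiability of the Perron eigenvalue\<close>

lemma Holder_sum_powr:
  fixes a b :: "'i \<Rightarrow> real"
  assumes "finite I" and al: "0 < \<alpha>" "\<alpha> < 1"
    and a: "\<And>i. i \<in> I \<Longrightarrow> 0 \<le> a i" and b: "\<And>i. i \<in> I \<Longrightarrow> 0 \<le> b i"
  shows "(\<Sum>i\<in>I. a i powr \<alpha> * b i powr (1 - \<alpha>)) \<le> (\<Sum>i\<in>I. a i) powr \<alpha> * (\<Sum>i\<in>I. b i) powr (1 - \<alpha>)"
proof (cases "(\<Sum>i\<in>I. a i) = 0 \<or> (\<Sum>i\<in>I. b i) = 0")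
  case True
  then have "(\<forall>i\<in>I. a i = 0) \<or> (\<forall>i\<in>I. b i = 0)"
    using sum_nonneg_eq_0_iff[OF assms(1)] a b by metis
  then have "(\<Sum>i\<in>I. a i powr \<alpha> * b i powr (1 - \<alpha>)) = 0" by (intro sum.neutral) auto
  then show ?thesis by simp
next
  case False
  define s t where "s = (\<Sum>i\<in>I. a i)" and "t = (\<Sum>i\<in>I. b i)"
  have st: "0 < s" "0 < t" using False sum_nonneg[of I a] sum_nonneg[of I b] a b
    by (force simp: s_def t_def)+
  have young: "a i powr \<alpha> * b i powr (1 - \<alpha>) \<le> s powr \<alpha> * t powr (1 - \<alpha>) * (\<alpha> * (a i / s) + (1 - \<alpha>) * (b i / t))"
    if i: "i \<in> I" for i
  proof (cases "a i = 0 \<or> b i = 0")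
    case True
    have "0 \<le> s powr \<alpha> * t powr (1 - \<alpha>) * (\<alpha> * (a i / s) + (1 - \<alpha>) * (b i / t))"
      using a[OF i] b[OF i] st al by (intro mult_nonneg_nonneg add_nonneg_nonneg) auto
    then show ?thesis using True by auto
  next
    case False
    then have pos: "0 < a i" "0 < b i" using a[OF i] b[OF i] by auto
    have "(a i / s) powr \<alpha> * (b i / t) powr (1 - \<alpha>) \<le> \<alpha> * (a i / s) + (1 - \<alpha>) * (b i / t)"
      using pos st al by (intro Youngs_inequality_0) auto
    then have "s powr \<alpha> * t powr (1 - \<alpha>) * ((a i / s) powr \<alpha> * (b i / t) powr (1 - \<alpha>))
        \<le> s powr \<alpha> * t powr (1 - \<alpha>) * (\<alpha> * (a i / s) + (1 - \<alpha>) * (b i / t))"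
      by (intro mult_left_mono) auto
    moreover have "s powr \<alpha> * t powr (1 - \<alpha>) * ((a i / s) powr \<alpha> * (b i / t) powr (1 - \<alpha>))
        = a i powr \<alpha> * b i powr (1 - \<alpha>)"
      using pos st by (simp add: powr_divide)
    ultimately show ?thesis by simp
  qed
  have "(\<Sum>i\<in>I. a i powr \<alpha> * b i powr (1 - \<alpha>))
      \<le> (\<Sum>i\<in>I. s powr \<alpha> * t powr (1 - \<alpha>) * (\<alpha> * (a i / s) + (1 - \<alpha>) * (b i / t)))"
    by (intro sum_mono young)
  also have "\<dots> = s powr \<alpha> * t powr (1 - \<alpha>) * (\<alpha> * (s / s) + (1 - \<alpha>) * (t / t))"
    by (simp add: s_def t_def sum.distrib flip: sum_distrib_left sum_divide_distrib)
  also have "\<dots> = s powr \<alpha> * t powr (1 - \<alpha>)" using st by simp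
  finally show ?thesis by (simp add: s_def t_def)
qed

text \<open>Kingman's log-convexity of the spectral radius: the entrywise geometric mean of the two
  Perron vectors is a subinvariant vector for the geometric mean of the matrices.\<close>
lemma pf_eig_geometric_mean_le:
  fixes A B C :: "'i::finite \<Rightarrow> 'i \<Rightarrow> real"
  assumes A: "irreducible_nonneg A" and B: "irreducible_nonneg B" and C: "irreducible_nonneg C"
    and al: "0 < \<alpha>" "\<alpha> < 1"
    and C_eq: "\<And>a b. C a b = A a b powr \<alpha> * B a b powr (1 - \<alpha>)"
  shows "pf_eig C \<le> pf_eig A powr \<alpha> * pf_eig B powr (1 - \<alpha>)"
proof -
  obtain v where v: "\<And>a. 0 < v a" "\<And>a. (\<Sum>b\<in>UNIV. A a b * v b) = pf_eig A * v a"
    using pf_eig_right[OF A] by metis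
  obtain w where w: "\<And>a. 0 < w a" "\<And>a. (\<Sum>b\<in>UNIV. B a b * w b) = pf_eig B * w a"
    using pf_eig_right[OF B] by metis
  note nn = irreducible_nonneg_nonneg[OF A] irreducible_nonneg_nonneg[OF B]
    less_imp_le[OF v(1)] less_imp_le[OF w(1)] less_imp_le[OF pf_eig_pos[OF A]] less_imp_le[OF pf_eig_pos[OF B]]
  show ?thesis
  proof (rule pf_eig_le[OF C])
    show "0 < v a powr \<alpha> * w a powr (1 - \<alpha>)" for a using v(1)[of a] w(1)[of a] by simp
    fix a
    have "(\<Sum>b\<in>UNIV. C a b * (v b powr \<alpha> * w b powr (1 - \<alpha>)))
        = (\<Sum>b\<in>UNIV. (A a b * v b) powr \<alpha> * (B a b * w b) powr (1 - \<alpha>))"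
      by (simp add: C_eq powr_mult nn mult_ac)
    also have "\<dots> \<le> (\<Sum>b\<in>UNIV. A a b * v b) powr \<alpha> * (\<Sum>b\<in>UNIV. B a b * w b) powr (1 - \<alpha>)"
      using al by (intro Holder_sum_powr) (auto intro!: mult_nonneg_nonneg nn)
    also have "\<dots> = pf_eig A powr \<alpha> * pf_eig B powr (1 - \<alpha>) * (v a powr \<alpha> * w a powr (1 - \<alpha>))"
      unfolding v(2) w(2) by (simp add: powr_mult nn mult_ac)
    finally show "(\<Sum>b\<in>UNIV. C a b * (v b powr \<alpha> * w b powr (1 - \<alpha>)))
        \<le> pf_eig A powr \<alpha> * pf_eig B powr (1 - \<alpha>) * (v a powr \<alpha> * w a powr (1 - \<alpha>))" .
  qed
qed

text \<open>Subtracting from \<open>w\<close> the largest multiple of \<open>v\<close> below it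
  leaves a nonnegative eigenvector with a zero entry, which by irreducibility vanishes. Of
  \<open>w\<close> only nonnegativity and some eigenvalue are assumed, since that is what survives
  in a limit of Perron vectors.\<close>

lemma Perron_vector_unique:
  fixes A :: "'i::finite \<Rightarrow> 'i \<Rightarrow> real"
  assumes A: "irreducible_nonneg A"
    and v: "\<And>a. 0 < v a" "\<And>a. (\<Sum>b\<in>UNIV. A a b * v b) = pf_eig A * v a" "(\<Sum>a\<in>UNIV. v a) = 1"
    and w: "\<And>a. 0 \<le> w a" "\<And>a. (\<Sum>b\<in>UNIV. A a b * w b) = l * w a" "(\<Sum>a\<in>UNIV. w a) = 1"
  shows "w = v"
proof -
  obtain a0 where "w a0 \<noteq> 0" using w(3) by (metis sum.neutral zero_neq_one)
  then have "0 < w a0" using w(1)[of a0] by simp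
  then have wpos: "0 < w a" for a
    by (rule irreducible_nonneg_eigvec_pos[OF A w(1) _ w(2)])
  have l: "pf_eig A = l"
    by (rule pf_eig_eqI[where v = w, OF irreducible_nonneg_nonneg[OF A] wpos w(2)])
  define t where "t = Min (range (\<lambda>a. w a / v a))"
  have le: "t * v a \<le> w a" for a
  proof -
    have "t \<le> w a / v a" unfolding t_def by (intro Min_le) auto
    then show ?thesis using v(1)[of a] by (simp add: le_divide_eq)
  qed
  have "t \<in> range (\<lambda>a. w a / v a)" unfolding t_def by (intro Min_in) auto
  then obtain a1 where "t = w a1 / v a1" by blast
  then have a1: "w a1 - t * v a1 = 0" using v(1)[of a1] by simp
  have "w a - t * v a = 0" for a
  proof (rule ccontr)
    assume "w a - t * v a \<noteq> 0"
    then have "0 < w a - t * v a" using le[of a] by simp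
    moreover have "(\<Sum>b\<in>UNIV. A c b * (w b - t * v b)) = l * (w c - t * v c)" for c
    proof -
      have "(\<Sum>b\<in>UNIV. A c b * (w b - t * v b)) = (\<Sum>b\<in>UNIV. A c b * w b) - t * (\<Sum>b\<in>UNIV. A c b * v b)"
        by (simp add: algebra_simps sum_subtractf sum_distrib_left)
      also have "\<dots> = l * (w c - t * v c)"
        unfolding v(2) w(2) l by (simp add: algebra_simps)
      finally show ?thesis .
    qed
    ultimately have "0 < w a1 - t * v a1"
      using irreducible_nonneg_eigvec_pos[OF A, where v = "\<lambda>a. w a - t * v a" and ?a0.0 = a and l = l and a = a1] le
      by simp
    then show False using a1 by simp
  qed
  then have w_eq: "w a = t * v a" for a by (simp add: algebra_simps)
  then have "t = 1" using w(3) v(3) by (simp flip: sum_distrib_left)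
  then show ?thesis using w_eq by auto
qed

text \<open>The Perron vector depends continuously on the matrix because its graph over a closed set of
  irreducible matrices is closed, by uniqueness of the nonnegative eigenvector.\<close>
lemma Perron_vector_continuous:
  fixes A0 :: "'i::finite \<Rightarrow> 'i \<Rightarrow> real"
  assumes A0: "irreducible_nonneg A0"
  defines "S \<equiv> {B::real^'i^'i. \<forall>a b. A0 a b / 2 \<le> B $ a $ b}"
  shows "\<exists>f. continuous_on S f \<and> (\<forall>B\<in>S. (\<forall>a. 0 < f B $ a) \<and>
    (\<forall>a. (\<Sum>b\<in>UNIV. B $ a $ b * f B $ b) = pf_eig (\<lambda>a b. B $ a $ b) * f B $ a))"
proof -
  \<comment> \<open>The factor 1/2 in \<open>S\<close> keeps every positive entry of
    \<open>A0\<close> positive, yet leaves room for all nonnegative matrices close to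
    \<open>A0\<close>; and \<open>S\<close> is closed.\<close>
  have irr: "irreducible_nonneg (\<lambda>a b. B $ a $ b)" if "B \<in> S" for B
  proof (rule irreducible_nonneg_mono[OF A0])
    fix a b
    have "A0 a b / 2 \<le> B $ a $ b" using that by (simp add: S_def)
    then show "0 \<le> B $ a $ b" "0 < A0 a b \<Longrightarrow> 0 < B $ a $ b"
      using irreducible_nonneg_nonneg[OF A0, of a b] by linarith+
  qed
  have "\<exists>v\<in>simplex_set. (\<forall>a. 0 < v $ a) \<and>
      (\<forall>a. (\<Sum>b\<in>UNIV. B $ a $ b * v $ b) = pf_eig (\<lambda>a b. B $ a $ b) * v $ a)" if B: "B \<in> S" for B
  proof -
    obtain v l where v: "v \<in> simplex_set" "\<forall>a. 0 < v $ a" "\<forall>a. (\<Sum>b\<in>UNIV. B $ a $ b * v $ b) = l * v $ a"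
      using Perron_Frobenius_simplex[OF irr[OF B]] by metis
    have "pf_eig (\<lambda>a b. B $ a $ b) = l"
      by (rule pf_eig_eqI[where v = "\<lambda>a. v $ a"]) (use v irreducible_nonneg_nonneg[OF irr[OF B]] in auto)
    then show ?thesis using v by auto
  qed
  then obtain f where f: "\<And>B. B \<in> S \<Longrightarrow> f B \<in> simplex_set" "\<And>B a. B \<in> S \<Longrightarrow> 0 < f B $ a"
    "\<And>B a. B \<in> S \<Longrightarrow> (\<Sum>b\<in>UNIV. B $ a $ b * f B $ b) = pf_eig (\<lambda>a b. B $ a $ b) * f B $ a"
  proof -
    assume *: "\<And>B. B \<in> S \<Longrightarrow> \<exists>v\<in>simplex_set. (\<forall>a. 0 < v $ a) \<and>
      (\<forall>a. (\<Sum>b\<in>UNIV. B $ a $ b * v $ b) = pf_eig (\<lambda>a b. B $ a $ b) * v $ a)"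
    have "\<forall>B\<in>S. \<exists>v. v \<in> simplex_set \<and> (\<forall>a. 0 < v $ a) \<and>
      (\<forall>a. (\<Sum>b\<in>UNIV. B $ a $ b * v $ b) = pf_eig (\<lambda>a b. B $ a $ b) * v $ a)"
      using * by blast
    from bchoice[OF this] show thesis using that by blast
  qed
  \<comment> \<open>Since \<open>v\<close> sums to 1, its eigenvalue is the sum of all entries of
    \<open>B v\<close>. Written this way the graph is cut out by polynomial conditions, so its
    closedness does not presuppose continuity of \<open>pf_eig\<close>.\<close>
  let ?G = "{(B::real^'i^'i, v::real^'i). B \<in> S \<and> v \<in> simplex_set \<and>
      (\<forall>a. (\<Sum>b\<in>UNIV. B $ a $ b * v $ b) = (\<Sum>c\<in>UNIV. \<Sum>b\<in>UNIV. B $ c $ b * v $ b) * v $ a)}"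
  have ev_sum: "(\<Sum>c\<in>UNIV. \<Sum>b\<in>UNIV. B $ c $ b * f B $ b) = pf_eig (\<lambda>a b. B $ a $ b)"
    if "B \<in> S" for B
    using f(1)[OF that] by (simp add: f(3)[OF that] simplex_set_def flip: sum_distrib_left)
  have "(\<lambda>B. (B, f B)) ` S = ?G"
  proof (intro equalityI subsetI)
    fix p assume "p \<in> (\<lambda>B. (B, f B)) ` S"
    then show "p \<in> ?G" using f ev_sum by auto
  next
    fix p assume "p \<in> ?G"
    then obtain B v where p: "p = (B, v)" "B \<in> S" "v \<in> simplex_set"
      "\<And>a. (\<Sum>b\<in>UNIV. B $ a $ b * v $ b) = (\<Sum>c\<in>UNIV. \<Sum>b\<in>UNIV. B $ c $ b * v $ b) * v $ a"
      by auto
    have "(\<lambda>a. v $ a) = (\<lambda>a. f B $ a)"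
      by (rule Perron_vector_unique[OF irr[OF p(2)] f(2)[OF p(2)] f(3)[OF p(2)] _ _ p(4)])
        (use p(3) f(1)[OF p(2)] in \<open>auto simp: simplex_set_def\<close>)
    then have "v = f B" by (simp add: vec_eq_iff fun_eq_iff)
    then show "p \<in> (\<lambda>B. (B, f B)) ` S" using p by auto
  qed
  moreover have "closed ?G"
  proof -
    have eq: "?G = (\<Inter>a. \<Inter>b. {p. A0 a b / 2 \<le> fst p $ a $ b}) \<inter> (UNIV \<times> simplex_set) \<inter>
       (\<Inter>a. {p. (\<Sum>b\<in>UNIV. fst p $ a $ b * snd p $ b) = (\<Sum>c\<in>UNIV. \<Sum>b\<in>UNIV. fst p $ c $ b * snd p $ b) * snd p $ a})"
      by (simp add: S_def set_eq_iff split_beta mem_Times_iff)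
    have "closed {p::(real^'i^'i) \<times> (real^'i). A0 a b / 2 \<le> fst p $ a $ b}" for a b
      by (intro closed_Collect_le continuous_intros)
    moreover have "closed {p::(real^'i^'i) \<times> (real^'i). (\<Sum>b\<in>UNIV. fst p $ a $ b * snd p $ b) =
         (\<Sum>c\<in>UNIV. \<Sum>b\<in>UNIV. fst p $ c $ b * snd p $ b) * snd p $ a}" for a
      by (intro closed_Collect_eq continuous_intros)
    moreover have "closed (UNIV \<times> (simplex_set :: (real^'i) set))"
      by (intro closed_Times closed_UNIV compact_imp_closed compact_simplex_set)
    ultimately show ?thesis unfolding eq by (intro closed_Int closed_INT ballI)
  qed
  ultimately have "continuous_on S f"
    by (intro continuous_from_closed_graph[OF compact_simplex_set]) (use f(1) in auto)
  then show ?thesis using f(2,3) by blast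
qed

text \<open>With \<open>u\<close> the left Perron vector of \<open>A t0\<close> and \<open>v t\<close> the right one of \<open>A t\<close>,
  \<open>(pf_eig (A t) - pf_eig (A t0)) * (u \<bullet> v t) = u \<bullet> (A t - A t0) v t\<close>.\<close>
lemma pf_eig_differentiable:
  fixes A :: "real \<Rightarrow> 'i::finite \<Rightarrow> 'i \<Rightarrow> real"
  assumes irr: "irreducible_nonneg (A t0)"
    and nn: "\<And>a b. eventually (\<lambda>t. 0 \<le> A t a b) (at t0)"
    and diff: "\<And>a b. (\<lambda>t. A t a b) differentiable (at t0)"
  shows "(\<lambda>t. pf_eig (A t)) differentiable (at t0)"
proof -
  define S where "S = {B::real^'i^'i. \<forall>a b. A t0 a b / 2 \<le> B $ a $ b}"
  obtain f where f0: "continuous_on S f \<and> (\<forall>B\<in>S. (\<forall>a. 0 < f B $ a) \<and>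
    (\<forall>a. (\<Sum>b\<in>UNIV. B $ a $ b * f B $ b) = pf_eig (\<lambda>a b. B $ a $ b) * f B $ a))"
    using Perron_vector_continuous[OF irr] unfolding S_def by (rule exE)
  have f: "continuous_on S f" "\<And>B a. B \<in> S \<Longrightarrow> 0 < f B $ a"
    "\<And>B a. B \<in> S \<Longrightarrow> (\<Sum>b\<in>UNIV. B $ a $ b * f B $ b) = pf_eig (\<lambda>a b. B $ a $ b) * f B $ a"
    using f0 by auto
  define M :: "real \<Rightarrow> real^'i^'i" where "M t = (\<chi> a b. A t a b)" for t
  have M_nth [simp]: "M t $ a $ b = A t a b" for t a b by (simp add: M_def)
  have lim_A: "((\<lambda>t. A t a b) \<longlongrightarrow> A t0 a b) (at t0)" for a b
    using differentiable_imp_continuous_within[OF diff] by (simp add: continuous_within)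
  have M0: "M t0 \<in> S"
    using irreducible_nonneg_nonneg[OF irr] by (simp add: S_def)
  have MS: "eventually (\<lambda>t. M t \<in> S) (at t0)"
  proof -
    \<comment> \<open>Positive entries stay above half their value by continuity; for zero entries
      the assumed nonnegativity decides.\<close>
    have "eventually (\<lambda>t. A t0 a b / 2 \<le> A t a b) (at t0)" for a b
    proof (cases "A t0 a b = 0")
      case True
      then show ?thesis using nn by simp
    next
      case False
      then have "A t0 a b / 2 < A t0 a b" using irreducible_nonneg_nonneg[OF irr, of a b] by simp
      from order_tendstoD(1)[OF lim_A this] show ?thesis
        by (rule eventually_mono) simp
    qed
    then show ?thesis by (simp add: S_def eventually_all_finite)
  qed
  have lim_M: "(M \<longlongrightarrow> M t0) (at t0)"
    unfolding M_def by (intro tendsto_vec_lambda lim_A)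
  have "((\<lambda>t. f (M t)) \<longlongrightarrow> f (M t0)) (at t0)"
    using f(1) M0 MS lim_M continuous_on_eq_continuous_within continuous_within_tendsto_compose by blast
  then have lim_v: "((\<lambda>t. f (M t) $ b) \<longlongrightarrow> f (M t0) $ b) (at t0)" for b
    by (rule tendsto_vec_nth)
  obtain u where u: "\<And>a. 0 < u a" "\<And>b. (\<Sum>a\<in>UNIV. u a * A t0 a b) = pf_eig (A t0) * u b"
    using pf_eig_left[OF irr] by metis
  obtain D where D: "\<And>a b. ((\<lambda>t. A t a b) has_real_derivative D a b) (at t0)"
    using diff unfolding real_differentiable_def by metis
  \<comment> \<open>The difference quotient of \<open>pf_eig\<close>, solved from the pairing
    identity. In it the Perron vector is not differenced, so its continuity suffices for the
    limit.\<close>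
  define Q where "Q t = (\<Sum>a\<in>UNIV. \<Sum>b\<in>UNIV. u a * ((A t a b - A t0 a b) / (t - t0)) * f (M t) $ b)
      / (\<Sum>a\<in>UNIV. u a * f (M t) $ a)" for t
  have uv: "0 < (\<Sum>a\<in>UNIV. u a * f B $ a)" if "B \<in> S" for B
    by (intro sum_pos) (auto simp: u f(2)[OF that])
  have "(Q \<longlongrightarrow> (\<Sum>a\<in>UNIV. \<Sum>b\<in>UNIV. u a * D a b * f (M t0) $ b) / (\<Sum>a\<in>UNIV. u a * f (M t0) $ a)) (at t0)"
    unfolding Q_def using D uv[OF M0]
    by (intro tendsto_intros lim_v) (auto simp: has_field_derivative_iff)
  moreover have "eventually (\<lambda>t. Q t = (pf_eig (A t) - pf_eig (A t0)) / (t - t0)) (at t0)"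
    using MS
  proof (rule eventually_mono)
    fix t assume t: "M t \<in> S"
    let ?v = "\<lambda>a. f (M t) $ a"
    have "(\<Sum>a\<in>UNIV. u a * (\<Sum>b\<in>UNIV. A t a b * ?v b)) - (\<Sum>a\<in>UNIV. u a * (\<Sum>b\<in>UNIV. A t0 a b * ?v b))
        = (pf_eig (A t) - pf_eig (A t0)) * (\<Sum>a\<in>UNIV. u a * ?v a)"
      using f(3)[OF t] unfolding bilinear_pairing[where A = "A t0" and u = u and x = ?v, OF u(2)]
      by (simp add: algebra_simps sum_distrib_left sum_subtractf)
    moreover have "(\<Sum>a\<in>UNIV. u a * (\<Sum>b\<in>UNIV. A t a b * ?v b)) - (\<Sum>a\<in>UNIV. u a * (\<Sum>b\<in>UNIV. A t0 a b * ?v b))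
        = (\<Sum>a\<in>UNIV. \<Sum>b\<in>UNIV. u a * (A t a b - A t0 a b) * ?v b)"
      by (simp add: algebra_simps sum_distrib_left flip: sum_subtractf)
    ultimately have "(\<Sum>a\<in>UNIV. \<Sum>b\<in>UNIV. u a * (A t a b - A t0 a b) * ?v b) / (t - t0)
        = (pf_eig (A t) - pf_eig (A t0)) / (t - t0) * (\<Sum>a\<in>UNIV. u a * ?v a)"
      by simp
    then show "Q t = (pf_eig (A t) - pf_eig (A t0)) / (t - t0)"
      using uv[OF t] by (simp add: Q_def sum_divide_distrib)
  qed
  ultimately have "((\<lambda>t. pf_eig (A t)) has_real_derivative
      (\<Sum>a\<in>UNIV. \<Sum>b\<in>UNIV. u a * D a b * f (M t0) $ b) / (\<Sum>a\<in>UNIV. u a * f (M t0) $ a)) (at t0)"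
    unfolding has_field_derivative_iff by (rule Lim_transform_eventually)
  then show ?thesis using real_differentiable_def by blast
qed

subsection \<open>Sums over paths\<close>

lemma sum_lists_Suc:
  fixes f :: "'a::finite list \<Rightarrow> real"
  shows "(\<Sum>xs\<in>{xs. length xs = Suc n}. f xs) = (\<Sum>a\<in>UNIV. \<Sum>xs\<in>{xs. length xs = n}. f (a # xs))"
proof -
  have "{xs :: 'a list. length xs = Suc n} = (\<lambda>(a, xs). a # xs) ` (UNIV \<times> {xs. length xs = n})"
    by (auto simp: length_Suc_conv)
  moreover have "inj_on (\<lambda>(a, xs). a # xs) (UNIV \<times> {xs :: 'a list. length xs = n})"
    by (auto simp: inj_on_def)
  ultimately show ?thesis
    by (simp add: sum.reindex sum.cartesian_product split_def)
qed

lemma finite_lists_length: "finite {xs :: 'a::finite list. length xs = n}"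
  using finite_lists_length_eq[of "UNIV :: 'a set" n] by simp

text \<open>As functions of \<open>b\<close> the sums form a row vector: all ones for
  \<open>n = 0\<close>, multiplied by \<open>A\<close> at each step. The vector of ones lies between
  \<open>v / M\<close> and \<open>v / m\<close> for the left Perron vector \<open>v\<close>, which
  each step scales by exactly \<open>pf_eig A\<close>.\<close>

lemma sum_mc_tail_bounds:
  fixes A :: "'i::finite \<Rightarrow> 'i \<Rightarrow> real"
  assumes A: "irreducible_nonneg A"
  obtains c C where "0 < c" "c \<le> C"
    "\<And>n b. c * pf_eig A ^ n \<le> (\<Sum>xs\<in>{xs. length xs = n}. mc_tail A b xs)"
    "\<And>n b. (\<Sum>xs\<in>{xs. length xs = n}. mc_tail A b xs) \<le> C * pf_eig A ^ n"
proof -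
  obtain v where v: "\<And>a. 0 < v a" "\<And>b. (\<Sum>a\<in>UNIV. v a * A a b) = pf_eig A * v b"
    using pf_eig_left[OF A] by metis
  let ?t = "\<lambda>n b. \<Sum>xs\<in>{xs. length xs = n}. mc_tail A b xs"
  have step: "?t (Suc n) b = (\<Sum>a\<in>UNIV. A a b * ?t n a)" for n b
    by (simp add: sum_lists_Suc sum_distrib_left)
  define m M where "m = Min (range v)" and "M = Max (range v)"
  have m: "m \<le> v a" and M: "v a \<le> M" for a
    by (auto simp: m_def M_def)
  have "m \<in> range v" unfolding m_def by (intro Min_in) auto
  then have m0: "0 < m" using v(1) by auto
  then have M0: "0 < M" using m[of undefined] M[of undefined] by linarith
  have lo: "pf_eig A ^ n * v b / M \<le> ?t n b" for n b
  proof (induction n arbitrary: b)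
    case 0
    then show ?case using M M0 by simp
  next
    case (Suc n)
    have "pf_eig A ^ Suc n * v b / M = pf_eig A ^ n / M * (\<Sum>a\<in>UNIV. v a * A a b)"
      unfolding v(2) by simp
    also have "\<dots> = (\<Sum>a\<in>UNIV. A a b * (pf_eig A ^ n * v a / M))"
      by (simp add: sum_distrib_left mult_ac)
    also have "\<dots> \<le> (\<Sum>a\<in>UNIV. A a b * ?t n a)"
      by (intro sum_mono mult_left_mono Suc irreducible_nonneg_nonneg[OF A])
    finally show ?case by (simp only: step)
  qed
  have hi: "?t n b \<le> pf_eig A ^ n * v b / m" for n b
  proof (induction n arbitrary: b)
    case 0
    then show ?case using m m0 by simp
  next
    case (Suc n)
    have "(\<Sum>a\<in>UNIV. A a b * ?t n a) \<le> (\<Sum>a\<in>UNIV. A a b * (pf_eig A ^ n * v a / m))"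
      by (intro sum_mono mult_left_mono Suc irreducible_nonneg_nonneg[OF A])
    also have "\<dots> = pf_eig A ^ n / m * (\<Sum>a\<in>UNIV. v a * A a b)"
      by (simp add: sum_distrib_left mult_ac)
    also have "\<dots> = pf_eig A ^ Suc n * v b / m"
      unfolding v(2) by simp
    finally show ?case by (simp only: step)
  qed
  have pw: "0 \<le> pf_eig A ^ n" for n using pf_eig_pos[OF A] by simp
  show ?thesis
  proof (rule that[of "m / M" "M / m"])
    show "0 < m / M" using m0 M0 by simp
    show "m / M \<le> M / m" using m0 M0 m[of undefined] M[of undefined] by (simp add: field_simps mult_mono)
    fix n b
    have "m / M * pf_eig A ^ n \<le> pf_eig A ^ n * v b / M"
      using m[of b] M0 pw[of n] by (simp add: field_simps mult_right_mono)
    then show "m / M * pf_eig A ^ n \<le> ?t n b" using lo[of n b] by linarith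
    have "pf_eig A ^ n * v b / m \<le> M / m * pf_eig A ^ n"
      using M[of b] m0 pw[of n] by (simp add: field_simps mult_right_mono)
    then show "?t n b \<le> M / m * pf_eig A ^ n" using hi[of b n] by linarith
  qed
qed

lemma sum_mc_prob_bounds:
  fixes A :: "'i::finite \<Rightarrow> 'i \<Rightarrow> real"
  assumes A: "irreducible_nonneg A" and p: "\<And>a. 0 \<le> p a" "0 < p a0"
  obtains c C where "0 < c" "0 < C"
    "\<And>n. c * pf_eig A ^ n \<le> (\<Sum>xs\<in>{xs. length xs = n}. mc_prob p A xs)"
    "\<And>n. (\<Sum>xs\<in>{xs. length xs = n}. mc_prob p A xs) \<le> C * pf_eig A ^ n"
proof -
  obtain c C where c: "0 < c" "c \<le> C"
    "\<And>n b. c * pf_eig A ^ n \<le> (\<Sum>xs\<in>{xs. length xs = n}. mc_tail A b xs)"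
    "\<And>n b. (\<Sum>xs\<in>{xs. length xs = n}. mc_tail A b xs) \<le> C * pf_eig A ^ n"
    using sum_mc_tail_bounds[OF A] by metis
  let ?s = "\<lambda>n. \<Sum>xs\<in>{xs. length xs = n}. mc_prob p A xs"
  define P where "P = (\<Sum>a\<in>UNIV. p a)"
  have P: "0 < P" unfolding P_def using p by (metis UNIV_I finite less_le sum_nonneg_0 sum_nonneg)
  have l: "0 < pf_eig A" by (rule pf_eig_pos[OF A])
  have Suc: "?s (Suc n) = (\<Sum>a\<in>UNIV. p a * (\<Sum>xs\<in>{xs. length xs = n}. mc_tail A a xs))" for n
    by (simp add: sum_lists_Suc sum_distrib_left)
  have lo: "P * (c * pf_eig A ^ n) \<le> ?s (Suc n)" for n
    unfolding Suc P_def sum_distrib_right by (intro sum_mono mult_left_mono c p)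
  have hi: "?s (Suc n) \<le> P * (C * pf_eig A ^ n)" for n
    unfolding Suc P_def sum_distrib_right by (intro sum_mono mult_left_mono c p)
  \<comment> \<open>The first letter is weighted by \<open>p\<close>, so a path of length
    \<open>n\<close> makes \<open>n - 1\<close> transitions, whence the division by
    \<open>pf_eig A\<close>. The empty path has weight 1, whence the \<open>1\<close> in
    \<open>min\<close> and \<open>max\<close>.\<close>
  show ?thesis
  proof (rule that[of "min 1 (P * c / pf_eig A)" "max 1 (P * C / pf_eig A)"])
    show "0 < min 1 (P * c / pf_eig A)" using P c l by simp
    show "0 < max 1 (P * C / pf_eig A)" by simp
    fix n
    show "min 1 (P * c / pf_eig A) * pf_eig A ^ n \<le> ?s n"
    proof (cases n)
      case (Suc k)
      have "min 1 (P * c / pf_eig A) * pf_eig A ^ n \<le> P * c / pf_eig A * pf_eig A ^ n"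
        using l by (intro mult_right_mono) auto
      also have "\<dots> = P * (c * pf_eig A ^ k)" using l by (simp add: Suc)
      finally show ?thesis using lo[of k] Suc by simp
    qed simp
    show "?s n \<le> max 1 (P * C / pf_eig A) * pf_eig A ^ n"
    proof (cases n)
      case (Suc k)
      have "P * (C * pf_eig A ^ k) = P * C / pf_eig A * pf_eig A ^ n" using l by (simp add: Suc)
      also have "\<dots> \<le> max 1 (P * C / pf_eig A) * pf_eig A ^ n"
        using l by (intro mult_right_mono) auto
      finally show ?thesis using hi[of k] Suc by simp
    qed simp
  qed
qed

subsection \<open>Tilted matrices and the channel exponent\<close>

text \<open>Serves the source with \<open>B\<close> constantly 1 and the channel with
  \<open>B = lift_snd V\<close>.\<close>

definition tilt :: "('i \<Rightarrow> 'i \<Rightarrow> real) \<Rightarrow> ('i \<Rightarrow> 'i \<Rightarrow> real) \<Rightarrow> real \<Rightarrow> 'i \<Rightarrow> 'i \<Rightarrow> real" where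
  "tilt A B \<theta> a b = A a b powr (1 - \<theta>) * B a b powr \<theta>"

definition log_pf_tilt :: "('i::finite \<Rightarrow> 'i \<Rightarrow> real) \<Rightarrow> ('i \<Rightarrow> 'i \<Rightarrow> real) \<Rightarrow> real \<Rightarrow> real" where
  "log_pf_tilt A B \<theta> = ln (pf_eig (tilt A B \<theta>))"

lemma irreducible_nonneg_tilt:
  assumes "irreducible_nonneg A" "\<And>a b. 0 < A a b \<Longrightarrow> 0 < B a b"
  shows "irreducible_nonneg (tilt A B \<theta>)"
proof (rule irreducible_nonneg_mono[OF assms(1)])
  show "0 < tilt A B \<theta> a b" if "0 < A a b" for a b
    using that assms(2)[OF that] by (simp add: tilt_def)
qed (simp add: tilt_def)

text \<open>The tilt at a convex combination of parameters is the entrywise geometric mean of the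
  two tilts, so log-convexity of \<open>pf_eig\<close> applies.\<close>

lemma log_pf_tilt_convex:
  assumes A: "irreducible_nonneg A" and B: "\<And>a b. 0 < A a b \<Longrightarrow> 0 < B a b"
  shows "convex_on UNIV (log_pf_tilt A B)"
proof (rule convex_onI)
  fix t x y :: real assume t: "0 < t" "t < 1"
  note irr = irreducible_nonneg_tilt[where A = A and B = B, OF A B]
  let ?z = "(1 - t) * x + t * y"
  have "pf_eig (tilt A B ?z) \<le> pf_eig (tilt A B x) powr (1 - t) * pf_eig (tilt A B y) powr (1 - (1 - t))"
  proof (rule pf_eig_geometric_mean_le[OF irr irr irr])
    fix a b
    have "A a b powr (1 - ?z) = A a b powr ((1 - x) * (1 - t) + (1 - y) * t)"
      by (simp add: algebra_simps)
    moreover have "B a b powr ?z = B a b powr (x * (1 - t) + y * t)"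
      by (simp add: algebra_simps)
    ultimately show "tilt A B ?z a b = tilt A B x a b powr (1 - t) * tilt A B y a b powr (1 - (1 - t))"
      by (simp add: tilt_def powr_mult powr_powr powr_add)
  qed (use t in auto)
  then have "ln (pf_eig (tilt A B ?z)) \<le> ln (pf_eig (tilt A B x) powr (1 - t) * pf_eig (tilt A B y) powr t)"
    using pf_eig_pos[OF irr] by (intro ln_mono) auto
  also have "\<dots> = (1 - t) * ln (pf_eig (tilt A B x)) + t * ln (pf_eig (tilt A B y))"
    using pf_eig_pos[OF irr, of x] pf_eig_pos[OF irr, of y] by (simp add: ln_mult ln_powr)
  finally show "log_pf_tilt A B ((1 - t) *\<^sub>R x + t *\<^sub>R y)
      \<le> (1 - t) * log_pf_tilt A B x + t * log_pf_tilt A B y"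
    by (simp add: log_pf_tilt_def)
qed simp

lemma ln_pf_eig_differentiable:
  fixes A :: "real \<Rightarrow> 'i::finite \<Rightarrow> 'i \<Rightarrow> real"
  assumes "irreducible_nonneg (A t0)" "\<And>a b. eventually (\<lambda>t. 0 \<le> A t a b) (at t0)"
    "\<And>a b. (\<lambda>t. A t a b) differentiable (at t0)"
  shows "(\<lambda>t. ln (pf_eig (A t))) differentiable (at t0)"
proof -
  obtain D where "((\<lambda>t. pf_eig (A t)) has_real_derivative D) (at t0)"
    using pf_eig_differentiable[OF assms] unfolding real_differentiable_def by blast
  from DERIV_chain2[OF DERIV_ln[OF pf_eig_pos[OF assms(1)]] this] show ?thesis
    using real_differentiable_def by blast
qed

lemma powr_const_differentiable:
  fixes c :: real
  shows "(\<lambda>t. c powr (1 - t)) differentiable (at t0)" "(\<lambda>t. c powr t) differentiable (at t0)"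
proof -
  have "((\<lambda>t. exp ((1 - t) * ln c)) has_real_derivative (- exp ((1 - t0) * ln c) * ln c)) (at t0)"
    "((\<lambda>t. exp (t * ln c)) has_real_derivative (exp (t0 * ln c) * ln c)) (at t0)"
    by (auto intro!: derivative_eq_intros)
  then show "(\<lambda>t. c powr (1 - t)) differentiable (at t0)" "(\<lambda>t. c powr t) differentiable (at t0)"
    unfolding powr_def by (cases "c = 0"; auto simp: real_differentiable_def)+
qed

lemma log_pf_tilt_differentiable:
  assumes A: "irreducible_nonneg A" and B: "\<And>a b. 0 < A a b \<Longrightarrow> 0 < B a b"
  shows "log_pf_tilt A B differentiable (at \<theta>)"
proof -
  have "(\<lambda>t. tilt A B t a b) differentiable (at \<theta>)" for a b
    unfolding tilt_def by (intro derivative_intros powr_const_differentiable)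
  then have "(\<lambda>t. ln (pf_eig (tilt A B t))) differentiable (at \<theta>)"
    by (intro ln_pf_eig_differentiable irreducible_nonneg_tilt A B) (simp_all add: tilt_def)
  then show ?thesis by (simp add: log_pf_tilt_def[abs_def])
qed

lemma log_pf_tilt_0:
  assumes A: "irreducible_nonneg A" "transition_matrix A" and B: "\<And>a b. 0 < A a b \<Longrightarrow> 0 < B a b"
  shows "log_pf_tilt A B 0 = 0"
proof -
  have "tilt A B 0 a b = A a b" for a b
    using irreducible_nonneg_nonneg[OF A(1), of a b] B[of a b]
    by (cases "A a b = 0") (auto simp: tilt_def)
  then have "tilt A B 0 = A" by blast
  then show ?thesis using pf_eig_stochastic[OF A] by (simp add: log_pf_tilt_def)
qed

text \<open>A crude row-sum bound, uniform in \<open>B\<close>; it makes the supremum over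
  \<open>V\<close> in \<open>H_up\<close> one of a bounded set.\<close>

lemma log_pf_tilt_le:
  fixes A B :: "'i::finite \<Rightarrow> 'i \<Rightarrow> real"
  assumes A: "irreducible_nonneg A" and B: "\<And>a b. 0 < A a b \<Longrightarrow> 0 < B a b"
    and le: "\<And>a b. 0 \<le> A a b" "\<And>a b. A a b \<le> 1" "\<And>a b. 0 \<le> B a b" "\<And>a b. B a b \<le> 1"
    and th: "0 \<le> \<theta>" "\<theta> \<le> 1"
  shows "log_pf_tilt A B \<theta> \<le> ln (real CARD('i))"
proof -
  have irr: "irreducible_nonneg (tilt A B \<theta>)" by (rule irreducible_nonneg_tilt[OF A B])
  have "pf_eig (tilt A B \<theta>) \<le> real CARD('i)"
  proof (rule pf_eig_le[OF irr, where x = "\<lambda>_. 1"])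
    fix a
    have "(\<Sum>b\<in>UNIV. tilt A B \<theta> a b * 1) \<le> (\<Sum>b::'i\<in>UNIV. 1)"
      unfolding tilt_def using th le by (intro sum_mono) (simp add: mult_le_one powr_le1)
    then show "(\<Sum>b\<in>UNIV. tilt A B \<theta> a b * 1) \<le> real CARD('i) * 1" by simp
  qed simp
  then show ?thesis
    unfolding log_pf_tilt_def using pf_eig_pos[OF irr] by (intro ln_mono) auto
qed

lemma transition_matrix_le_1:
  fixes W :: "'i::finite \<Rightarrow> 'i \<Rightarrow> real"
  assumes "transition_matrix W"
  shows "W a b \<le> 1"
proof -
  have "W a b \<le> (\<Sum>a\<in>UNIV. W a b)"
    using assms by (intro member_le_sum) (auto simp: transition_matrix_def)
  then show ?thesis using assms by (simp add: transition_matrix_def)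
qed

lemma sum_UNIV_prod:
  fixes f :: "'x::finite \<times> 'z::finite \<Rightarrow> real"
  shows "(\<Sum>p\<in>UNIV. f p) = (\<Sum>z\<in>UNIV. \<Sum>x\<in>UNIV. f (x, z))"
proof -
  have "(\<Sum>p\<in>UNIV. f p) = (\<Sum>x\<in>UNIV. \<Sum>z\<in>UNIV. f (x, z))"
    unfolding sum.cartesian_product by simp
  also have "\<dots> = (\<Sum>z\<in>UNIV. \<Sum>x\<in>UNIV. f (x, z))" by (rule sum.swap)
  finally show ?thesis .
qed

definition lift_snd :: "('z \<Rightarrow> 'z \<Rightarrow> real) \<Rightarrow> 'x \<times> 'z \<Rightarrow> 'x \<times> 'z \<Rightarrow> real" where
  "lift_snd V p q = V (snd p) (snd q)"

text \<open>The preimage under \<open>snd\<close> of a set closed for \<open>B\<close> is closed for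
  \<open>W\<close>.\<close>

lemma irreducible_nonneg_marginal:
  fixes W :: "'x \<times> 'z \<Rightarrow> 'x \<times> 'z \<Rightarrow> real"
  assumes W: "irreducible_nonneg W" and B: "\<And>z z'. 0 \<le> B z z'"
    and pos: "\<And>x z x' z'. 0 < W (x, z) (x', z') \<Longrightarrow> 0 < B z z'"
  shows "irreducible_nonneg B"
  unfolding irreducible_nonneg_def
proof (intro conjI allI impI)
  show "\<exists>a b. 0 < B a b" using W pos unfolding irreducible_nonneg_def by (metis surj_pair)
  fix S :: "'z set"
  assume S: "S \<noteq> {}" "\<forall>a b. b \<in> S \<longrightarrow> 0 < B a b \<longrightarrow> a \<in> S"
  then obtain z0 where z0: "z0 \<in> S" by blast
  have "(undefined :: 'x, z) \<in> {p. snd p \<in> S}" for z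
  proof (rule irreducible_nonneg_closed[OF W])
    show "(undefined :: 'x, z0) \<in> {p. snd p \<in> S}" using z0 by simp
    show "p \<in> {p. snd p \<in> S}" if "q \<in> {p. snd p \<in> S}" "0 < W p q" for p q
      using that S(2) pos by (cases p; cases q) auto
  qed
  then show "S = UNIV" by auto
qed (rule B)

section \<open>The channel noise and its conditional entropies\<close>

locale channel =
  fixes Wc :: "'x::{finite,ab_group_add} \<times> 'z::finite \<Rightarrow> 'x \<times> 'z \<Rightarrow> real"
  assumes Wc: "irred_aperiodic_transition Wc" and A2: "assumption2 Wc"
begin

lemma Wc_transition: "transition_matrix Wc"
  using Wc by (simp add: irred_aperiodic_transition_def)

lemma Wc_nonneg: "0 \<le> Wc p q"
  using Wc_transition unfolding transition_matrix_def by blast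

lemma Wc_irreducible: "irreducible_nonneg Wc"
  using Wc Wc_nonneg by (intro irreducible_nonneg_irreducible_mat) (auto simp: irred_aperiodic_transition_def)

text \<open>\<open>WcZ\<close> is evaluated at \<open>x' = 0\<close>, so positivity seen from
  another \<open>x'\<close> must be transported there: alternative (i) does so at \<theta> = 0, and
  for a single side-information symbol the marginal is 1. As a result the tilted channel matrix has
  the support of \<open>Wc\<close> for every admissible \<open>V\<close>.\<close>

lemma WcZ_pos:
  assumes "0 < Wc (x, z) (x', z')"
  shows "0 < WcZ Wc z z'"
  using A2 unfolding assumption2_def
proof
  assume "\<forall>\<theta><1. \<forall>z z' x1 x2. (\<Sum>x\<in>UNIV. Wc (x, z) (x1, z') powr (1 - \<theta>))
                           = (\<Sum>x\<in>UNIV. Wc (x, z) (x2, z') powr (1 - \<theta>))"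
  then have "(\<Sum>x\<in>UNIV. Wc (x, z) (0, z') powr (1 - 0)) = (\<Sum>x\<in>UNIV. Wc (x, z) (x', z') powr (1 - 0))"
    by (metis zero_less_one)
  then have "WcZ Wc z z' = (\<Sum>x\<in>UNIV. Wc (x, z) (x', z'))"
    by (simp add: WcZ_def Wc_nonneg)
  moreover have "Wc (x, z) (x', z') \<le> (\<Sum>x\<in>UNIV. Wc (x, z) (x', z'))"
    by (intro member_le_sum) (auto simp: Wc_nonneg)
  ultimately show ?thesis using assms by simp
next
  assume "CARD('z) = 1"
  then obtain z0 where z0: "(UNIV :: 'z set) = {z0}" by (auto simp: card_1_singleton_iff)
  then have "z = z0" by auto
  moreover have "(\<Sum>p\<in>UNIV. Wc p (0, z')) = 1"
    using Wc_transition by (simp add: transition_matrix_def)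
  ultimately have "WcZ Wc z z' = 1" unfolding sum_UNIV_prod WcZ_def z0 by simp
  then show ?thesis by simp
qed

lemma admissible_nonneg: "admissible_V Wc V \<Longrightarrow> 0 \<le> V z z'"
  by (simp add: admissible_V_def transition_matrix_def)

lemma admissible_pos: "admissible_V Wc V \<Longrightarrow> 0 < Wc p q \<Longrightarrow> 0 < lift_snd V p q"
  using WcZ_pos by (cases p; cases q) (auto simp: admissible_V_def lift_snd_def)

lemma WcZ_admissible: "admissible_V Wc (WcZ Wc)"
proof -
  have "(\<Sum>p\<in>UNIV. Wc p (0, z')) = 1" for z'
    using Wc_transition by (simp add: transition_matrix_def)
  then show ?thesis
    by (auto simp: admissible_V_def transition_matrix_def WcZ_def Wc_nonneg sum_nonneg sum_UNIV_prod)
qed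

lemma admissible_irreducible:
  assumes "admissible_V Wc V"
  shows "irreducible_nonneg V"
  by (rule irreducible_nonneg_marginal[OF Wc_irreducible admissible_nonneg[OF assms]])
    (drule admissible_pos[OF assms], simp add: lift_snd_def)

lemma H_cond_V_eq: "H_cond_V Wc V \<theta> = (1 / \<theta>) * log_pf_tilt Wc (lift_snd V) \<theta>"
proof -
  have "(\<lambda>(x, z) (x', z'). Wc (x, z) (x', z') powr (1 - \<theta>) * V z z' powr \<theta>) = tilt Wc (lift_snd V) \<theta>"
    by (auto simp: fun_eq_iff tilt_def lift_snd_def)
  then show ?thesis by (simp add: H_cond_V_def log_pf_tilt_def)
qed

lemma H_cond_V_bdd_above:
  assumes "0 < \<theta>" "\<theta> \<le> 1"
  shows "bdd_above ((\<lambda>V. H_cond_V Wc V \<theta>) ` {V. admissible_V Wc V})"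
proof (rule bdd_aboveI2)
  fix V assume "V \<in> {V. admissible_V Wc V}"
  then have V: "admissible_V Wc V" by simp
  then have "log_pf_tilt Wc (lift_snd V) \<theta> \<le> ln (real CARD('x \<times> 'z))"
    using assms Wc_nonneg transition_matrix_le_1[OF Wc_transition] transition_matrix_le_1[of V]
    by (intro log_pf_tilt_le Wc_irreducible admissible_pos)
      (auto simp: lift_snd_def admissible_V_def transition_matrix_def)
  then show "H_cond_V Wc V \<theta> \<le> (1 / \<theta>) * ln (real CARD('x \<times> 'z))"
    using assms(1) unfolding H_cond_V_eq by (intro mult_left_mono) auto
qed

lemma H_cond_V_le_H_up:
  assumes "0 < \<theta>" "\<theta> \<le> 1" "admissible_V Wc V"
  shows "H_cond_V Wc V \<theta> \<le> H_up Wc \<theta>"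
  unfolding H_up_def using assms by (intro cSUP_upper H_cond_V_bdd_above) auto

lemma H_up_approx:
  assumes "0 < \<theta>" "\<theta> \<le> 1" "c < H_up Wc \<theta>"
  shows "\<exists>V. admissible_V Wc V \<and> c < H_cond_V Wc V \<theta>"
proof -
  have "{V. admissible_V Wc V} \<noteq> {}" using WcZ_admissible by blast
  from less_cSUP_iff[OF this H_cond_V_bdd_above[OF assms(1,2)]] assms(3)
  show ?thesis unfolding H_up_def by blast
qed

end

section \<open>The supremum over side-information chains as a single Perron eigenvalue\<close>

context channel
begin

definition cond_sum :: "real \<Rightarrow> 'z \<Rightarrow> 'z \<Rightarrow> real" where
  "cond_sum \<theta> z z' = (\<Sum>x\<in>UNIV. Wc (x, z) (0, z') powr (1 - \<theta>))"

text \<open>A Markov form of Arimoto's conditional Renyi entropy. The exponent is the one for which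
  \<open>cond_sum \<theta> * V powr \<theta>\<close> is the geometric mean of
  \<open>up_mat \<theta>\<close> and \<open>V\<close> with weights \<open>1 - \<theta>\<close> and
  \<open>\<theta>\<close>.\<close>

definition up_mat :: "real \<Rightarrow> 'z \<Rightarrow> 'z \<Rightarrow> real" where
  "up_mat \<theta> z z' = cond_sum \<theta> z z' powr (1 / (1 - \<theta>))"

lemma cond_sum_nonneg: "0 \<le> cond_sum \<theta> z z'"
  by (simp add: cond_sum_def sum_nonneg)

lemma cond_sum_diff:
  shows "(\<lambda>t. cond_sum t z z') differentiable (at \<theta>)"
  unfolding cond_sum_def by (intro derivative_intros powr_const_differentiable ballI) simp_all

context
  assumes A2i: "\<And>\<theta> z z' x1 x2. \<theta> < 1 \<Longrightarrow> (\<Sum>x\<in>UNIV. Wc (x, z) (x1, z') powr (1 - \<theta>))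
                           = (\<Sum>x\<in>UNIV. Wc (x, z) (x2, z') powr (1 - \<theta>))"
begin

lemma cond_sum_eq: "\<theta> < 1 \<Longrightarrow> (\<Sum>x\<in>UNIV. Wc (x, z) (x', z') powr (1 - \<theta>)) = cond_sum \<theta> z z'"
  unfolding cond_sum_def by (rule A2i)

lemma cond_sum_pos:
  assumes "\<theta> < 1" "0 < Wc (x, z) (x', z')"
  shows "0 < cond_sum \<theta> z z'"
proof -
  have "0 < Wc (x, z) (x', z') powr (1 - \<theta>)" using assms(2) by simp
  also have "\<dots> \<le> (\<Sum>x\<in>UNIV. Wc (x, z) (x', z') powr (1 - \<theta>))"
    by (intro member_le_sum) auto
  finally show ?thesis by (simp add: cond_sum_eq[OF assms(1)])
qed

lemma up_mat_irreducible: "\<theta> < 1 \<Longrightarrow> irreducible_nonneg (up_mat \<theta>)"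
proof (rule irreducible_nonneg_marginal[OF Wc_irreducible])
  show "0 < up_mat \<theta> z z'" if "\<theta> < 1" "0 < Wc (x, z) (x', z')" for x z x' z'
    using cond_sum_pos[OF that] by (simp add: up_mat_def)
qed (simp_all add: up_mat_def)

text \<open>Summing out \<open>x\<close>: a left Perron vector of \<open>cond_sum \<theta> * V powr \<theta>\<close> lifts to one of the
  tilted channel matrix that does not depend on \<open>x\<close>.\<close>
lemma pf_eig_tilt_lift:
  assumes th: "\<theta> < 1" and V: "admissible_V Wc V" and u: "\<And>z. 0 < u z"
    and ev: "\<And>z'. (\<Sum>z\<in>UNIV. u z * (cond_sum \<theta> z z' * V z z' powr \<theta>)) = l * u z'"
  shows "pf_eig (tilt Wc (lift_snd V) \<theta>) = l"
proof (rule pf_eig_eqI_left[OF irreducible_nonneg_tilt[OF Wc_irreducible admissible_pos[OF V]]])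
  show "0 < u (snd p)" for p :: "'x \<times> 'z" by (rule u)
  fix q :: "'x \<times> 'z"
  obtain x' z' where q: "q = (x', z')" by (cases q)
  have "(\<Sum>p\<in>UNIV. u (snd p) * tilt Wc (lift_snd V) \<theta> p q)
      = (\<Sum>z\<in>UNIV. \<Sum>x\<in>UNIV. u z * V z z' powr \<theta> * Wc (x, z) (x', z') powr (1 - \<theta>))"
    by (simp add: sum_UNIV_prod tilt_def lift_snd_def q mult_ac)
  also have "\<dots> = (\<Sum>z\<in>UNIV. u z * (cond_sum \<theta> z z' * V z z' powr \<theta>))"
    by (simp add: cond_sum_eq[OF th] mult_ac flip: sum_distrib_left)
  finally show "(\<Sum>p\<in>UNIV. u (snd p) * tilt Wc (lift_snd V) \<theta> p q) = l * u (snd q)"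
    by (simp add: ev q)
qed

text \<open>In the geometric-mean bound \<open>V\<close> contributes its own Perron eigenvalue,
  which is 1 for a transition matrix; what remains does not depend on \<open>V\<close>.\<close>

lemma log_pf_tilt_le_up_mat:
  assumes th: "0 < \<theta>" "\<theta> < 1" and V: "admissible_V Wc V"
  shows "log_pf_tilt Wc (lift_snd V) \<theta> \<le> (1 - \<theta>) * ln (pf_eig (up_mat \<theta>))"
proof -
  define B where "B z z' = cond_sum \<theta> z z' * V z z' powr \<theta>" for z z'
  have B: "irreducible_nonneg B"
  proof (rule irreducible_nonneg_marginal[OF Wc_irreducible])
    show "0 \<le> B z z'" for z z' by (simp add: B_def cond_sum_nonneg)
    fix x z x' z' assume pos: "0 < Wc (x, z) (x', z')"
    then have "0 < V z z'" using admissible_pos[OF V pos] by (simp add: lift_snd_def)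
    then show "0 < B z z'" using cond_sum_pos[OF th(2) pos] by (simp add: B_def)
  qed
  obtain u where u: "\<And>z. 0 < u z" "\<And>z'. (\<Sum>z\<in>UNIV. u z * B z z') = pf_eig B * u z'"
    using pf_eig_left[OF B] by metis
  have eq: "pf_eig (tilt Wc (lift_snd V) \<theta>) = pf_eig B"
    by (rule pf_eig_tilt_lift[OF th(2) V u(1)]) (use u(2) in \<open>simp add: B_def\<close>)
  note K = up_mat_irreducible[OF th(2)]
  have "pf_eig B \<le> pf_eig (up_mat \<theta>) powr (1 - \<theta>) * pf_eig V powr (1 - (1 - \<theta>))"
    using th cond_sum_nonneg
    by (intro pf_eig_geometric_mean_le[OF K admissible_irreducible[OF V] B])
      (auto simp: B_def up_mat_def powr_powr)
  also have "\<dots> = pf_eig (up_mat \<theta>) powr (1 - \<theta>)"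
    using pf_eig_stochastic[OF admissible_irreducible[OF V]] V by (simp add: admissible_V_def)
  finally have "ln (pf_eig B) \<le> ln (pf_eig (up_mat \<theta>) powr (1 - \<theta>))"
    using pf_eig_pos[OF B] by (intro ln_mono) auto
  then show ?thesis using pf_eig_pos[OF K] by (simp add: log_pf_tilt_def eq ln_powr)
qed

text \<open>The optimal \<open>V\<close> is the Doob transform of \<open>up_mat \<theta>\<close>.\<close>
lemma up_mat_attained:
  assumes th: "0 < \<theta>" "\<theta> < 1"
  shows "\<exists>V. admissible_V Wc V \<and> log_pf_tilt Wc (lift_snd V) \<theta> = (1 - \<theta>) * ln (pf_eig (up_mat \<theta>))"
proof -
  note K = up_mat_irreducible[OF th(2)]
  define l where "l = pf_eig (up_mat \<theta>)"
  have l: "0 < l" unfolding l_def by (rule pf_eig_pos[OF K])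
  obtain w where w: "\<And>z. 0 < w z" "\<And>z'. (\<Sum>z\<in>UNIV. w z * up_mat \<theta> z z') = l * w z'"
    using pf_eig_left[OF K] unfolding l_def by metis
  define V where "V z z' = w z * up_mat \<theta> z z' / (l * w z')" for z z'
  have wz: "0 \<le> w z" "w z \<noteq> 0" for z using w(1)[of z] by auto
  have Knn: "0 \<le> up_mat \<theta> z z'" for z z' by (simp add: up_mat_def)
  have V: "admissible_V Wc V"
    unfolding admissible_V_def transition_matrix_def
  proof (intro conjI allI impI)
    show "0 \<le> V z z'" for z z' using l wz Knn by (simp add: V_def)
    show "(\<Sum>z\<in>UNIV. V z z') = 1" for z'
      using l wz[of z'] by (simp add: V_def w(2) flip: sum_divide_distrib)
    fix z z' assume "0 < WcZ Wc z z'"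
    then have "(\<Sum>x\<in>UNIV. Wc (x, z) (0, z')) \<noteq> 0" by (simp add: WcZ_def)
    then obtain x where "Wc (x, z) (0, z') \<noteq> 0" by (meson sum.neutral)
    then have "0 < Wc (x, z) (0, z')" using Wc_nonneg[of "(x, z)" "(0, z')"] by simp
    then have "0 < cond_sum \<theta> z z'" by (rule cond_sum_pos[OF th(2)])
    then show "0 < V z z'" using l w(1) by (simp add: V_def up_mat_def)
  qed
  \<comment> \<open>The left eigenvector is \<open>w powr (1 - \<theta>)\<close>: the factor
    \<open>w powr \<theta>\<close> inside \<open>V powr \<theta>\<close> completes it to
    \<open>w\<close>, and \<open>cond_sum \<theta> * up_mat \<theta> powr \<theta>\<close> is again
    \<open>up_mat \<theta>\<close>, so the equation reduces to that of \<open>w\<close>.\<close>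
  have "pf_eig (tilt Wc (lift_snd V) \<theta>) = l powr (1 - \<theta>)"
  proof (rule pf_eig_tilt_lift[OF th(2) V])
    show "0 < w z powr (1 - \<theta>)" for z using w(1)[of z] by simp
    fix z'
    have term_eq: "w z powr (1 - \<theta>) * (cond_sum \<theta> z z' * V z z' powr \<theta>)
        = w z * up_mat \<theta> z z' / (l powr \<theta> * w z' powr \<theta>)" for z
    proof -
      have "1 + 1 / (1 - \<theta>) * \<theta> = 1 / (1 - \<theta>)" using th by (simp add: field_simps)
      then have "cond_sum \<theta> z z' powr 1 * cond_sum \<theta> z z' powr (1 / (1 - \<theta>) * \<theta>) = up_mat \<theta> z z'"
        by (simp only: up_mat_def flip: powr_add)
      then have NK: "cond_sum \<theta> z z' * up_mat \<theta> z z' powr \<theta> = up_mat \<theta> z z'"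
        using cond_sum_nonneg by (simp add: up_mat_def powr_powr)
      have ww: "w z powr (1 - \<theta>) * w z powr \<theta> = w z"
        using wz[of z] by (simp flip: powr_add)
      have Vth: "V z z' powr \<theta> = w z powr \<theta> * up_mat \<theta> z z' powr \<theta> / (l powr \<theta> * w z' powr \<theta>)"
        using wz l Knn by (simp add: V_def powr_divide powr_mult)
      have "w z powr (1 - \<theta>) * (cond_sum \<theta> z z' * V z z' powr \<theta>)
          = (w z powr (1 - \<theta>) * w z powr \<theta>) * (cond_sum \<theta> z z' * up_mat \<theta> z z' powr \<theta>)
            / (l powr \<theta> * w z' powr \<theta>)"
        unfolding Vth by (simp only: times_divide_eq_right mult_ac)
      then show ?thesis unfolding NK ww .
    qed
    have "(\<Sum>z\<in>UNIV. w z powr (1 - \<theta>) * (cond_sum \<theta> z z' * V z z' powr \<theta>))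
        = l * w z' / (l powr \<theta> * w z' powr \<theta>)"
      by (simp add: term_eq w(2) flip: sum_divide_distrib)
    also have "\<dots> = l powr (1 - \<theta>) * w z' powr (1 - \<theta>)"
      using l wz[of z'] by (simp add: powr_diff)
    finally show "(\<Sum>z\<in>UNIV. w z powr (1 - \<theta>) * (cond_sum \<theta> z z' * V z z' powr \<theta>))
        = l powr (1 - \<theta>) * w z' powr (1 - \<theta>)" .
  qed
  then have "log_pf_tilt Wc (lift_snd V) \<theta> = (1 - \<theta>) * ln (pf_eig (up_mat \<theta>))"
    using l by (simp add: log_pf_tilt_def l_def ln_powr)
  then show ?thesis using V by blast
qed

lemma H_up_eq_up_mat:
  assumes th: "0 < \<theta>" "\<theta> < 1"
  shows "H_up Wc \<theta> = (1 / \<theta>) * ((1 - \<theta>) * ln (pf_eig (up_mat \<theta>)))"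
  unfolding H_up_def
proof (rule cSup_eq_maximum)
  show "(1 / \<theta>) * ((1 - \<theta>) * ln (pf_eig (up_mat \<theta>)))
      \<in> (\<lambda>V. H_cond_V Wc V \<theta>) ` {V. admissible_V Wc V}"
    using up_mat_attained[OF th] by (force simp: H_cond_V_eq)
  fix h assume "h \<in> (\<lambda>V. H_cond_V Wc V \<theta>) ` {V. admissible_V Wc V}"
  then obtain V where "admissible_V Wc V" "h = H_cond_V Wc V \<theta>" by blast
  then show "h \<le> (1 / \<theta>) * ((1 - \<theta>) * ln (pf_eig (up_mat \<theta>)))"
    using log_pf_tilt_le_up_mat[OF th] th unfolding H_cond_V_eq by (simp add: divide_right_mono)
qed

lemma up_mat_differentiable:
  assumes "\<theta> < 1"
  shows "(\<lambda>t. up_mat t z z') differentiable (at \<theta>)"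
proof (cases "\<exists>x. 0 < Wc (x, z) (0, z')")
  case True
  then have pos: "0 < cond_sum \<theta> z z'" using cond_sum_pos[OF assms] by blast
  obtain D where D: "((\<lambda>t. cond_sum t z z') has_real_derivative D) (at \<theta>)"
    using cond_sum_diff real_differentiable_def by blast
  have "((\<lambda>t. 1 / (1 - t)) has_real_derivative 1 / (1 - \<theta>)^2) (at \<theta>)"
    using assms by (auto intro!: derivative_eq_intros simp: power2_eq_square)
  from DERIV_powr[where g = "\<lambda>t. cond_sum t z z'", OF D pos this] show ?thesis
    unfolding up_mat_def real_differentiable_def by blast
next
  case False
  then have "Wc (x, z) (0, z') = 0" for x using Wc_nonneg[of "(x, z)" "(0, z')"] by (metis less_eq_real_def)
  then show ?thesis by (simp add: up_mat_def cond_sum_def)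
qed

lemma ln_pf_eig_up_mat_differentiable:
  assumes "\<theta> < 1"
  shows "(\<lambda>t. ln (pf_eig (up_mat t))) differentiable (at \<theta>)"
  by (rule ln_pf_eig_differentiable[OF up_mat_irreducible[OF assms] _ up_mat_differentiable[OF assms]])
    (simp add: up_mat_def)

end

text \<open>In both cases of Assumption 2, \<theta> times the supremum is an explicit differentiable
  function on the open unit interval. With one side-information symbol the only admissible
  \<open>V\<close> is \<open>WcZ Wc\<close>, so the supremum runs over a single tilt.\<close>

lemma H_up_differentiable:
  assumes th: "0 < \<theta>" "\<theta> < 1"
  shows "H_up Wc differentiable (at \<theta>)"
proof -
  have "\<exists>g. g differentiable (at \<theta>) \<and> (\<forall>t. 0 < t \<longrightarrow> t < 1 \<longrightarrow> H_up Wc t = (1 / t) * g t)"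
    using A2 unfolding assumption2_def
  proof
    assume "\<forall>\<theta><1. \<forall>z z' x1 x2. (\<Sum>x\<in>UNIV. Wc (x, z) (x1, z') powr (1 - \<theta>))
                           = (\<Sum>x\<in>UNIV. Wc (x, z) (x2, z') powr (1 - \<theta>))"
    then have A2i: "\<And>\<theta> z z' x1 x2. \<theta> < 1 \<Longrightarrow> (\<Sum>x\<in>UNIV. Wc (x, z) (x1, z') powr (1 - \<theta>))
                           = (\<Sum>x\<in>UNIV. Wc (x, z) (x2, z') powr (1 - \<theta>))" by blast
    show ?thesis
      using H_up_eq_up_mat[OF A2i] ln_pf_eig_up_mat_differentiable[OF A2i th(2)]
      by (intro exI[of _ "\<lambda>t. (1 - t) * ln (pf_eig (up_mat t))"]) (auto intro!: derivative_intros)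
  next
    assume "CARD('z) = 1"
    then obtain z0 where z0: "(UNIV :: 'z set) = {z0}" by (auto simp: card_1_singleton_iff)
    have "V = WcZ Wc" if "admissible_V Wc V" for V
    proof (intro ext)
      fix z z'
      have "z = z0" using z0 by auto
      moreover have "(\<Sum>z\<in>UNIV. V z z') = (\<Sum>z\<in>UNIV. WcZ Wc z z')"
        using that WcZ_admissible by (simp add: admissible_V_def transition_matrix_def)
      ultimately show "V z z' = WcZ Wc z z'" unfolding z0 by simp
    qed
    then have "{V. admissible_V Wc V} = {WcZ Wc}" using WcZ_admissible by blast
    then have "H_up Wc t = (1 / t) * log_pf_tilt Wc (lift_snd (WcZ Wc)) t" for t
      by (simp add: H_up_def H_cond_V_eq)
    moreover have "log_pf_tilt Wc (lift_snd (WcZ Wc)) differentiable (at \<theta>)"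
      by (rule log_pf_tilt_differentiable[OF Wc_irreducible admissible_pos[OF WcZ_admissible]])
    ultimately show ?thesis by blast
  qed
  then obtain g where g: "g differentiable (at \<theta>)" "\<And>t. 0 < t \<Longrightarrow> t < 1 \<Longrightarrow> H_up Wc t = (1 / t) * g t"
    by blast
  have "(\<lambda>t. (1 / t) * g t) differentiable (at \<theta>)"
    using g(1) th by (intro derivative_intros) auto
  then obtain D where D: "((\<lambda>t. (1 / t) * g t) has_real_derivative D) (at \<theta>)"
    using real_differentiable_def by blast
  have "(H_up Wc has_real_derivative D) (at \<theta>)"
    by (rule has_field_derivative_transform_within_open[OF D, of "{0<..<1}"]) (use th g(2) in auto)
  then show ?thesis using real_differentiable_def by blast
qed

end

section \<open>The joint exponent function of source and channel\<close>

locale source_channel = channel Wc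
  for Wc :: "'x::{finite,ab_group_add} \<times> 'z::finite \<Rightarrow> 'x \<times> 'z \<Rightarrow> real" +
  fixes Ws :: "'m::finite \<Rightarrow> 'm \<Rightarrow> real" and r :: real
  assumes Ws: "irred_aperiodic_transition Ws" and r: "0 < r"
begin

lemma Ws_transition: "transition_matrix Ws"
  using Ws by (simp add: irred_aperiodic_transition_def)

lemma Ws_nonneg: "0 \<le> Ws a b"
  using Ws_transition by (simp add: transition_matrix_def)

lemma Ws_irreducible: "irreducible_nonneg Ws"
  using Ws Ws_nonneg by (intro irreducible_nonneg_irreducible_mat) (auto simp: irred_aperiodic_transition_def)

definition U_V :: "('z \<Rightarrow> 'z \<Rightarrow> real) \<Rightarrow> real \<Rightarrow> real" where
  "U_V V \<theta> = r * log_pf_tilt Ws (\<lambda>_ _. 1) \<theta> + log_pf_tilt Wc (lift_snd V) \<theta>"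

abbreviation "U \<equiv> U_up Ws Wc r"

lemma H_src_eq: "\<theta> \<noteq> 0 \<Longrightarrow> \<theta> * H_src Ws \<theta> = log_pf_tilt Ws (\<lambda>_ _. 1) \<theta>"
  by (simp add: H_src_def log_pf_tilt_def tilt_def[abs_def])

text \<open>The factor \<theta> removes the values at 0 of \<open>H_src\<close>, a
  \<open>Lim\<close>, and of \<open>H_up\<close>, where \<open>1 / 0\<close> occurs.\<close>

lemma U_0 [simp]: "U 0 = 0" by (simp add: U_up_def)

lemma U_eq: "\<theta> \<noteq> 0 \<Longrightarrow> U \<theta> = r * log_pf_tilt Ws (\<lambda>_ _. 1) \<theta> + \<theta> * H_up Wc \<theta>"
  by (simp add: U_up_def flip: H_src_eq)

lemma U_V_0: "admissible_V Wc V \<Longrightarrow> U_V V 0 = 0"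
  by (simp add: U_V_def log_pf_tilt_0[OF Ws_irreducible Ws_transition]
      log_pf_tilt_0[OF Wc_irreducible Wc_transition admissible_pos])

lemma U_V_le_U:
  assumes "0 \<le> \<theta>" "\<theta> \<le> 1" and V: "admissible_V Wc V"
  shows "U_V V \<theta> \<le> U \<theta>"
proof (cases "\<theta> = 0")
  case False
  then have th: "0 < \<theta>" using assms by simp
  have "\<theta> * H_cond_V Wc V \<theta> \<le> \<theta> * H_up Wc \<theta>"
    using H_cond_V_le_H_up[OF th assms(2) V] th by simp
  then show ?thesis using th by (simp add: U_V_def U_eq H_cond_V_eq)
qed (simp add: U_V_0[OF V])

text \<open>Covers both end points: at 0 every admissible \<open>V\<close> is exact, and at 1, where
  \<open>up_mat\<close> is undefined in substance, the supremum itself yields a near-optimal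
  \<open>V\<close>.\<close>

lemma U_V_approx:
  assumes "0 \<le> \<theta>" "\<theta> \<le> 1" "0 < \<epsilon>"
  shows "\<exists>V. admissible_V Wc V \<and> U \<theta> - \<epsilon> < U_V V \<theta>"
proof (cases "\<theta> = 0")
  case True
  then show ?thesis using WcZ_admissible U_V_0[OF WcZ_admissible] assms(3) by auto
next
  case False
  then have th: "0 < \<theta>" using assms by simp
  have "H_up Wc \<theta> - \<epsilon> / \<theta> < H_up Wc \<theta>" using th assms(3) by simp
  from H_up_approx[OF th assms(2) this] obtain V
    where V: "admissible_V Wc V" "H_up Wc \<theta> - \<epsilon> / \<theta> < H_cond_V Wc V \<theta>" by blast
  have "\<theta> * (H_up Wc \<theta> - \<epsilon> / \<theta>) < \<theta> * H_cond_V Wc V \<theta>"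
    using V(2) th by simp
  then have "U \<theta> - \<epsilon> < U_V V \<theta>" using th by (simp add: U_V_def U_eq H_cond_V_eq right_diff_distrib)
  then show ?thesis using V(1) by blast
qed

lemma U_V_convex:
  assumes V: "admissible_V Wc V"
  shows "convex_on UNIV (U_V V)"
proof -
  have "convex_on UNIV (\<lambda>\<theta>. r * log_pf_tilt Ws (\<lambda>_ _. 1) \<theta> + log_pf_tilt Wc (lift_snd V) \<theta>)"
    using r by (intro convex_on_add convex_on_cmul log_pf_tilt_convex Ws_irreducible Wc_irreducible
        admissible_pos[OF V]) auto
  then show ?thesis by (simp add: U_V_def[abs_def])
qed

lemma U_convex: "convex_on {0..1} U"
proof (rule convex_onI)
  fix t x y :: real assume t: "0 < t" "t < 1" and xy: "x \<in> {0..1}" "y \<in> {0..1}"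
  let ?z = "(1 - t) * x + t * y"
  have z: "0 \<le> ?z" "?z \<le> 1"
    using t xy convex_bound_le[of x 1 y "1 - t" t] by auto
  show "U ((1 - t) *\<^sub>R x + t *\<^sub>R y) \<le> (1 - t) * U x + t * U y"
  proof (rule field_le_epsilon)
    fix \<epsilon> :: real assume "0 < \<epsilon>"
    from U_V_approx[OF z this] obtain V where V: "admissible_V Wc V" "U ?z - \<epsilon> < U_V V ?z" by blast
    have "U_V V ?z \<le> (1 - t) * U_V V x + t * U_V V y"
      using convex_onD[OF U_V_convex[OF V(1)], of t x y] t by simp
    also have "\<dots> \<le> (1 - t) * U x + t * U y"
      using t xy by (intro add_mono mult_left_mono U_V_le_U V) auto
    finally show "U ((1 - t) *\<^sub>R x + t *\<^sub>R y) \<le> (1 - t) * U x + t * U y + \<epsilon>"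
      using V(2) by simp
  qed
qed simp

lemma U_differentiable:
  assumes th: "0 < \<theta>" "\<theta> < 1"
  shows "U differentiable (at \<theta>)"
proof -
  have "(\<lambda>t. r * log_pf_tilt Ws (\<lambda>_ _. 1) t + t * H_up Wc t) differentiable (at \<theta>)"
    by (intro derivative_intros log_pf_tilt_differentiable Ws_irreducible H_up_differentiable th) auto
  then obtain D where D: "((\<lambda>t. r * log_pf_tilt Ws (\<lambda>_ _. 1) t + t * H_up Wc t) has_real_derivative D) (at \<theta>)"
    using real_differentiable_def by blast
  have "(U has_real_derivative D) (at \<theta>)"
    by (rule has_field_derivative_transform_within_open[OF D, of "{0<..}"]) (use th U_eq in auto)
  then show ?thesis using real_differentiable_def by blast
qed

end

subsection \<open>The one-shot converse\<close>

lemma mc_tail_nonneg: "(\<And>a b. 0 \<le> A a b) \<Longrightarrow> 0 \<le> mc_tail A b xs"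
  by (induction xs arbitrary: b) auto

lemma mc_prob_nonneg: "(\<And>a. 0 \<le> p a) \<Longrightarrow> (\<And>a b. 0 \<le> A a b) \<Longrightarrow> 0 \<le> mc_prob p A xs"
  by (cases xs) (simp_all add: mc_tail_nonneg)

lemma mc_tail_tilt:
  assumes "\<And>a b. 0 \<le> A a b" "\<And>a b. 0 \<le> B a b"
  shows "mc_tail (tilt A B \<theta>) b xs = mc_tail A b xs powr (1 - \<theta>) * mc_tail B b xs powr \<theta>"
  by (induction xs arbitrary: b) (simp_all add: tilt_def powr_mult mc_tail_nonneg assms)

text \<open>The bridge between the two halves of the argument: tilted path weights, to which Hoelder
  applies, are the path weights of one matrix, whose sums grow like powers of its Perron
  eigenvalue.\<close>

lemma mc_prob_tilt:
  assumes "\<And>a. 0 \<le> p a" "\<And>a b. 0 \<le> A a b" "\<And>a. 0 \<le> q a" "\<And>a b. 0 \<le> B a b"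
  shows "mc_prob (\<lambda>a. p a powr (1 - \<theta>) * q a powr \<theta>) (tilt A B \<theta>) xs
    = mc_prob p A xs powr (1 - \<theta>) * mc_prob q B xs powr \<theta>"
  by (cases xs) (simp_all add: mc_tail_tilt powr_mult mc_tail_nonneg assms)

lemma sum_mc_prob_const:
  fixes A :: "'i::finite \<Rightarrow> 'i \<Rightarrow> real"
  assumes p: "(\<Sum>a\<in>UNIV. p a) = s" and A: "\<And>b. (\<Sum>a\<in>UNIV. A a b) = s"
  shows "(\<Sum>xs\<in>{xs. length xs = n}. mc_prob p A xs) = s ^ n"
proof -
  have tail: "(\<Sum>xs\<in>{xs. length xs = n}. mc_tail A b xs) = s ^ n" for n b
    by (induction n arbitrary: b) (simp_all add: sum_lists_Suc A flip: sum_distrib_left sum_distrib_right)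
  show ?thesis
    by (cases n) (simp_all add: sum_lists_Suc tail p flip: sum_distrib_left sum_distrib_right)
qed

lemma mc_prob_one: "mc_prob (\<lambda>_. 1) (\<lambda>_ _. 1) xs = 1"
proof -
  have "mc_tail (\<lambda>_ _. 1) b xs = 1" for b :: 'a and xs by (induction xs arbitrary: b) auto
  then show ?thesis by (cases xs) auto
qed

lemma mc_prob_lift_snd: "mc_prob (\<lambda>_. c) (lift_snd V) ys = mc_prob (\<lambda>_. c) V (map snd ys)"
proof -
  have "mc_tail (lift_snd V) q ys = mc_tail V (snd q) (map snd ys)" for q and ys :: "('a \<times> 'b) list"
    by (induction ys arbitrary: q) (auto simp: lift_snd_def)
  then show ?thesis by (cases ys) auto
qed

text \<open>The noise sequence that turns the sent word \<open>xt\<close> into the output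
  \<open>ys\<close>, in the form used by \<open>avg_err\<close>.\<close>

definition shift :: "('x::ab_group_add \<times> 'z) list \<Rightarrow> 'x list \<Rightarrow> ('x \<times> 'z) list" where
  "shift ys xt = map2 (\<lambda>(y, z) xt. (y - xt, z)) ys xt"

lemma length_shift: "length xt = length ys \<Longrightarrow> length (shift ys xt) = length ys"
  by (simp add: shift_def)

lemma map_snd_shift: "length ys = length xt \<Longrightarrow> map snd (shift ys xt) = map snd ys"
  by (induction ys xt rule: list_induct2) (auto simp: shift_def)

lemma shift_uminus: "length ys = length xt \<Longrightarrow> shift (shift ys xt) (map uminus xt) = ys"
  "length ys = length xt \<Longrightarrow> shift (shift ys (map uminus xt)) xt = ys"
  by (induction ys xt rule: list_induct2) (auto simp: shift_def)

lemma sum_shift: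
  fixes f :: "('x::{finite,ab_group_add} \<times> 'z::finite) list \<Rightarrow> real"
  assumes "length xt = n"
  shows "(\<Sum>ys\<in>{ys. length ys = n}. f (shift ys xt)) = (\<Sum>ys\<in>{ys. length ys = n}. f ys)"
  by (rule sum.reindex_bij_witness[where i = "\<lambda>ys. shift ys (map uminus xt)" and j = "\<lambda>ys. shift ys xt"])
    (use assms in \<open>auto simp: shift_uminus length_shift\<close>)

text \<open>Two applications of Hoelder: on \<open>C\<close> the tilted weight interpolates between the
  \<open>\<theta>1\<close>-tilt and \<open>b\<close>, off \<open>C\<close> between \<open>a\<close> and the \<open>\<theta>2\<close>-tilt.\<close>
lemma tilted_sum_le:
  fixes a b :: "'i \<Rightarrow> real"
  assumes I: "finite I" "C \<subseteq> I" and a: "\<And>i. 0 \<le> a i" and b: "\<And>i. 0 \<le> b i"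
    and th: "\<theta>1 < \<theta>" "\<theta> < \<theta>2" "0 < \<theta>" "\<theta> < 1"
  defines "\<alpha> \<equiv> (1 - \<theta>) / (1 - \<theta>1)" and "\<beta> \<equiv> \<theta> / \<theta>2"
    and "T \<equiv> \<lambda>t i. a i powr (1 - t) * b i powr t"
  shows "(\<Sum>i\<in>I. T \<theta> i) \<le> (\<Sum>i\<in>I. T \<theta>1 i) powr \<alpha> * (\<Sum>i\<in>C. b i) powr (1 - \<alpha>)
      + (\<Sum>i\<in>I. T \<theta>2 i) powr \<beta> * (\<Sum>i\<in>I - C. a i) powr (1 - \<beta>)"
proof -
  have al: "0 < \<alpha>" "\<alpha> < 1" and be: "0 < \<beta>" "\<beta> < 1" using th by (auto simp: \<alpha>_def \<beta>_def)
  have T: "0 \<le> T t i" for t i by (simp add: T_def)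
  have fin: "finite C" "finite (I - C)" using I finite_subset by auto
  \<comment> \<open>\<open>\<alpha>\<close> is determined by the exponent of \<open>a\<close>, which
    occurs only in the first factor; as the exponents add up to 1, that of \<open>b\<close> then
    fits. In \<open>E_eq\<close> the roles are exchanged and the exponent of \<open>b\<close>
    determines \<open>\<beta>\<close>.\<close>
  have C_eq: "T \<theta> i = T \<theta>1 i powr \<alpha> * b i powr (1 - \<alpha>)" for i
  proof -
    have e1: "(1 - \<theta>1) * \<alpha> = 1 - \<theta>" using th by (simp add: \<alpha>_def)
    then have "\<theta>1 * \<alpha> + (1 - \<alpha>) = \<theta>" by (simp add: algebra_simps)
    note e = e1 this
    have "T \<theta>1 i powr \<alpha> * b i powr (1 - \<alpha>) = a i powr ((1 - \<theta>1) * \<alpha>) * (b i powr (\<theta>1 * \<alpha>) * b i powr (1 - \<alpha>))"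
      by (simp add: T_def powr_mult powr_powr)
    then show ?thesis by (simp only: T_def e flip: powr_add)
  qed
  have E_eq: "T \<theta> i = T \<theta>2 i powr \<beta> * a i powr (1 - \<beta>)" for i
  proof -
    have e1: "\<theta>2 * \<beta> = \<theta>" using th by (simp add: \<beta>_def)
    then have "(1 - \<theta>2) * \<beta> + (1 - \<beta>) = 1 - \<theta>" by (simp add: algebra_simps)
    note e = e1 this
    have "T \<theta>2 i powr \<beta> * a i powr (1 - \<beta>) = (a i powr ((1 - \<theta>2) * \<beta>) * a i powr (1 - \<beta>)) * b i powr (\<theta>2 * \<beta>)"
      by (simp add: T_def powr_mult powr_powr)
    then show ?thesis by (simp only: T_def e flip: powr_add)
  qed
  have "(\<Sum>i\<in>C. T \<theta> i) \<le> (\<Sum>i\<in>C. T \<theta>1 i) powr \<alpha> * (\<Sum>i\<in>C. b i) powr (1 - \<alpha>)"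
    unfolding C_eq using al fin b T by (intro Holder_sum_powr) auto
  also have "\<dots> \<le> (\<Sum>i\<in>I. T \<theta>1 i) powr \<alpha> * (\<Sum>i\<in>C. b i) powr (1 - \<alpha>)"
    using al T I by (intro mult_right_mono powr_mono2 sum_mono2 sum_nonneg) auto
  finally have 1: "(\<Sum>i\<in>C. T \<theta> i) \<le> \<dots>" .
  have "(\<Sum>i\<in>I - C. T \<theta> i) \<le> (\<Sum>i\<in>I - C. T \<theta>2 i) powr \<beta> * (\<Sum>i\<in>I - C. a i) powr (1 - \<beta>)"
    unfolding E_eq using be fin a T by (intro Holder_sum_powr) auto
  also have "\<dots> \<le> (\<Sum>i\<in>I. T \<theta>2 i) powr \<beta> * (\<Sum>i\<in>I - C. a i) powr (1 - \<beta>)"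
    using be T I by (intro mult_right_mono powr_mono2 sum_mono2 sum_nonneg) auto
  finally have 2: "(\<Sum>i\<in>I - C. T \<theta> i) \<le> \<dots>" .
  have "(\<Sum>i\<in>I. T \<theta> i) = (\<Sum>i\<in>C. T \<theta> i) + (\<Sum>i\<in>I - C. T \<theta> i)"
    using I by (simp add: sum.subset_diff)
  then show ?thesis using 1 2 by linarith
qed

lemma distribution_obtain_pos:
  assumes "distribution P"
  obtains a where "0 < P a"
proof -
  have "(\<Sum>a\<in>UNIV. P a) \<noteq> 0" using assms by (simp add: distribution_def)
  then obtain a where "P a \<noteq> 0" by (meson sum.neutral)
  then have "0 < P a" using assms by (metis distribution_def less_eq_real_def)
  then show ?thesis by (rule that)
qed

locale coding = source_channel Wc Ws r
  for Wc :: "'x::{finite,ab_group_add} \<times> 'z::finite \<Rightarrow> 'x \<times> 'z \<Rightarrow> real"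
    and Ws :: "'m::finite \<Rightarrow> 'm \<Rightarrow> real" and r +
  fixes PM1 :: "'m \<Rightarrow> real" and PXZ1 :: "'x \<times> 'z \<Rightarrow> real"
  assumes PM1: "distribution PM1" and PXZ1: "distribution PXZ1"
begin

definition src_sum :: "nat \<Rightarrow> real \<Rightarrow> real" where
  "src_sum k t = (\<Sum>ms\<in>{ms. length ms = k}.
     mc_prob (\<lambda>a. PM1 a powr (1 - t) * 1 powr t) (tilt Ws (\<lambda>_ _. 1) t) ms)"

text \<open>The comparison chain \<open>V\<close> starts from the uniform law. It is positive
  everywhere, and lifted to pairs it sums to \<open>CARD('x)\<close>, exactly like each column of
  \<open>lift_snd V\<close>.\<close>

definition chan_sum :: "('z \<Rightarrow> 'z \<Rightarrow> real) \<Rightarrow> nat \<Rightarrow> real \<Rightarrow> real" where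
  "chan_sum V n t = (\<Sum>ys\<in>{ys. length ys = n}.
     mc_prob (\<lambda>p. PXZ1 p powr (1 - t) * (1 / real CARD('z)) powr t) (tilt Wc (lift_snd V) t) ys)"

text \<open>The Hoelder bound over pairs of message and output, with \<open>a\<close> their joint
  probability and \<open>b\<close> the \<open>V\<close>-weight of the output. The correct pairs
  \<open>C\<close> form part of the graph of \<open>d\<close>, so each output is counted at most
  once and \<open>b\<close> sums over \<open>C\<close> to at most \<open>CARD('x) ^ n\<close>. The
  full sums factor into source and channel for every code.\<close>

lemma one_shot_converse:
  assumes V: "admissible_V Wc V"
    and len: "\<And>ms. length ms = k \<Longrightarrow> length (e ms) = n"
    and th: "\<theta>1 < \<theta>" "\<theta> < \<theta>2" "0 < \<theta>" "\<theta> < 1"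
  defines "\<alpha> \<equiv> (1 - \<theta>) / (1 - \<theta>1)" and "\<beta> \<equiv> \<theta> / \<theta>2"
  shows "src_sum k \<theta> * chan_sum V n \<theta>
      \<le> (src_sum k \<theta>1 * chan_sum V n \<theta>1) powr \<alpha> * (real CARD('x) ^ n) powr (1 - \<alpha>)
      + (src_sum k \<theta>2 * chan_sum V n \<theta>2) powr \<beta> * avg_err PM1 Ws PXZ1 Wc k n e d powr (1 - \<beta>)"
proof -
  define M where "M = {ms :: 'm list. length ms = k}"
  define Y where "Y = {ys :: ('x \<times> 'z) list. length ys = n}"
  have fin: "finite M" "finite Y" by (simp_all add: M_def Y_def finite_lists_length)
  define p where "p ms = mc_prob PM1 Ws ms" for ms
  define q where "q ys = mc_prob PXZ1 Wc ys" for ys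
  define g where "g ys = mc_prob (\<lambda>_. 1 / real CARD('z)) (lift_snd V) ys" for ys :: "('x \<times> 'z) list"
  have nn: "0 \<le> PM1 m" "0 \<le> PXZ1 xz" for m xz
    using PM1 PXZ1 by (simp_all add: distribution_def del: split_paired_All)
  have Vnn: "0 \<le> lift_snd V x y" for x y :: "'x \<times> 'z"
    using admissible_nonneg[OF V] by (simp add: lift_snd_def)
  have pos: "0 \<le> p ms" "0 \<le> q ys" "0 \<le> g ys" for ms ys
    by (auto simp: p_def q_def g_def intro!: mc_prob_nonneg nn Vnn Ws_nonneg Wc_nonneg)
  have src: "src_sum k t = (\<Sum>ms\<in>M. p ms powr (1 - t))" for t
    unfolding src_sum_def M_def p_def
    using mc_prob_tilt[where p = PM1 and A = Ws and q = "\<lambda>_. 1" and B = "\<lambda>_ _. 1"]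
    by (simp add: nn Ws_nonneg mc_prob_one)
  have chan: "chan_sum V n t = (\<Sum>ys\<in>Y. q ys powr (1 - t) * g ys powr t)" for t
    unfolding chan_sum_def Y_def q_def g_def
    using mc_prob_tilt[where p = PXZ1 and A = Wc and q = "\<lambda>_. 1 / real CARD('z)" and B = "lift_snd V"]
    by (simp add: nn Wc_nonneg Vnn)
  define a where "a = (\<lambda>(ms, ys). p ms * q (shift ys (e ms)))"
  define b where "b = (\<lambda>(ms :: 'm list, ys). g ys)"
  define C where "C = {(ms, ys) \<in> M \<times> Y. d ys = ms}"
  have total: "(\<Sum>i\<in>M \<times> Y. a i powr (1 - t) * b i powr t) = src_sum k t * chan_sum V n t" for t
  proof -
    have inner: "(\<Sum>ys\<in>Y. q (shift ys (e ms)) powr (1 - t) * g ys powr t) = chan_sum V n t"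
      if ms: "ms \<in> M" for ms
    proof -
      have l: "length (e ms) = n" using len ms by (simp add: M_def)
      \<comment> \<open>\<open>g\<close> sees only the side information, which the codeword leaves
        unchanged, so it may be shifted along with \<open>q\<close>; translation by the codeword
        then permutes the outputs.\<close>
      have "(\<Sum>ys\<in>Y. q (shift ys (e ms)) powr (1 - t) * g ys powr t)
          = (\<Sum>ys\<in>Y. q (shift ys (e ms)) powr (1 - t) * g (shift ys (e ms)) powr t)"
        by (intro sum.cong) (auto simp: g_def mc_prob_lift_snd map_snd_shift l Y_def)
      also have "\<dots> = chan_sum V n t"
        unfolding chan Y_def by (rule sum_shift[OF l, where f = "\<lambda>ys. q ys powr (1 - t) * g ys powr t"])
      finally show ?thesis .
    qed
    have "(\<Sum>i\<in>M \<times> Y. a i powr (1 - t) * b i powr t)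
        = (\<Sum>ms\<in>M. \<Sum>ys\<in>Y. p ms powr (1 - t) * (q (shift ys (e ms)) powr (1 - t) * g ys powr t))"
      by (simp add: sum.cartesian_product a_def b_def split_def powr_mult pos mult.assoc)
    also have "\<dots> = src_sum k t * chan_sum V n t"
      by (simp add: inner src sum_distrib_right flip: sum_distrib_left)
    finally show ?thesis .
  qed
  have err: "(\<Sum>i\<in>M \<times> Y - C. a i) = avg_err PM1 Ws PXZ1 Wc k n e d"
  proof -
    have "(\<Sum>i\<in>M \<times> Y - C. a i) = (\<Sum>i\<in>M \<times> Y. if d (snd i) \<noteq> fst i then a i else 0)"
      using fin by (intro sum.mono_neutral_cong_left) (auto simp: C_def)
    also have "\<dots> = (\<Sum>ms\<in>M. p ms * (\<Sum>ys\<in>Y. if d ys \<noteq> ms then q (shift ys (e ms)) else 0))"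
      by (simp add: sum.cartesian_product sum_distrib_left a_def split_def if_distrib cong: if_cong)
    also have "\<dots> = avg_err PM1 Ws PXZ1 Wc k n e d"
      unfolding avg_err_def M_def Y_def p_def q_def shift_def ..
    finally show ?thesis .
  qed
  have corr: "(\<Sum>i\<in>C. b i) \<le> real CARD('x) ^ n"
  proof -
    have "(\<Sum>i\<in>C. b i) = (\<Sum>ys\<in>snd ` C. g ys)"
      using sum.reindex[of snd C g] by (auto simp: inj_on_def C_def b_def split_def)
    also have "\<dots> \<le> (\<Sum>ys\<in>Y. g ys)"
      using fin pos by (intro sum_mono2) (auto simp: C_def)
    also have "\<dots> = real CARD('x) ^ n"
      unfolding Y_def g_def
    proof (rule sum_mc_prob_const)
      have "real CARD('x) * (\<Sum>z\<in>UNIV. V z z') = real CARD('x)" for z'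
        using V by (simp add: admissible_V_def transition_matrix_def)
      then show "(\<Sum>p\<in>UNIV. lift_snd V p q) = real CARD('x)" for q :: "'x \<times> 'z"
        by (simp add: sum_UNIV_prod lift_snd_def flip: sum_distrib_left)
    qed simp
    finally show ?thesis .
  qed
  have "\<alpha> < 1" using th by (simp add: \<alpha>_def)
  moreover have "0 \<le> (\<Sum>i\<in>C. b i)" by (intro sum_nonneg) (auto simp: b_def pos)
  ultimately have "(\<Sum>i\<in>C. b i) powr (1 - \<alpha>) \<le> (real CARD('x) ^ n) powr (1 - \<alpha>)"
    using corr by (intro powr_mono2) auto
  then have "(src_sum k \<theta>1 * chan_sum V n \<theta>1) powr \<alpha> * (\<Sum>i\<in>C. b i) powr (1 - \<alpha>)
      \<le> (src_sum k \<theta>1 * chan_sum V n \<theta>1) powr \<alpha> * (real CARD('x) ^ n) powr (1 - \<alpha>)"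
    by (intro mult_left_mono) auto
  moreover have "src_sum k \<theta> * chan_sum V n \<theta>
      \<le> (src_sum k \<theta>1 * chan_sum V n \<theta>1) powr \<alpha> * (\<Sum>i\<in>C. b i) powr (1 - \<alpha>)
      + (src_sum k \<theta>2 * chan_sum V n \<theta>2) powr \<beta> * avg_err PM1 Ws PXZ1 Wc k n e d powr (1 - \<beta>)"
    unfolding total[symmetric] err[symmetric] \<alpha>_def \<beta>_def
    by (rule tilted_sum_le) (use fin th pos in \<open>auto simp: C_def a_def b_def\<close>)
  ultimately show ?thesis by linarith
qed

text \<open>Rounding \<open>r * n\<close> down changes the source exponent by at most
  \<open>\<bar>f\<bar>\<close>, which the constants absorb.\<close>

lemma total_sum_bounds:
  assumes V: "admissible_V Wc V"
  obtains c C where "0 < c" "0 < C"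
    "\<And>n. c * exp (real n * U_V V t) \<le> src_sum (nat \<lfloor>r * real n\<rfloor>) t * chan_sum V n t"
    "\<And>n. src_sum (nat \<lfloor>r * real n\<rfloor>) t * chan_sum V n t \<le> C * exp (real n * U_V V t)"
proof -
  obtain m where m: "0 < PM1 m" using distribution_obtain_pos[OF PM1] by blast
  obtain p where p: "0 < PXZ1 p" using distribution_obtain_pos[OF PXZ1] by blast
  define f h where "f = log_pf_tilt Ws (\<lambda>_ _. 1) t" and "h = log_pf_tilt Wc (lift_snd V) t"
  have irr: "irreducible_nonneg (tilt Ws (\<lambda>_ _. 1) t)" "irreducible_nonneg (tilt Wc (lift_snd V) t)"
    by (simp_all add: irreducible_nonneg_tilt Ws_irreducible Wc_irreducible admissible_pos[OF V])
  have pw: "pf_eig (tilt Ws (\<lambda>_ _. 1) t) ^ k = exp (real k * f)"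
    "pf_eig (tilt Wc (lift_snd V) t) ^ k = exp (real k * h)" for k
    using pf_eig_pos[OF irr(1)] pf_eig_pos[OF irr(2)]
    by (simp_all add: f_def h_def log_pf_tilt_def exp_of_nat_mult)
  obtain c1 C1 where c1: "0 < c1" "0 < C1" "\<And>k. c1 * exp (real k * f) \<le> src_sum k t"
    "\<And>k. src_sum k t \<le> C1 * exp (real k * f)"
    using sum_mc_prob_bounds[OF irr(1), of "\<lambda>a. PM1 a powr (1 - t) * 1 powr t" m] m
    unfolding src_sum_def pw by auto
  obtain c2 C2 where c2: "0 < c2" "0 < C2" "\<And>n. c2 * exp (real n * h) \<le> chan_sum V n t"
    "\<And>n. chan_sum V n t \<le> C2 * exp (real n * h)"
    using sum_mc_prob_bounds[OF irr(2), of "\<lambda>p. PXZ1 p powr (1 - t) * (1 / real CARD('z)) powr t" p] p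
    unfolding chan_sum_def pw by auto
  have floor: "\<bar>real (nat \<lfloor>r * real n\<rfloor>) * f - r * real n * f\<bar> \<le> \<bar>f\<bar>" for n
  proof -
    have "0 \<le> r * real n" using r by simp
    then have "\<bar>real (nat \<lfloor>r * real n\<rfloor>) - r * real n\<bar> \<le> 1" by linarith
    then have "\<bar>real (nat \<lfloor>r * real n\<rfloor>) - r * real n\<bar> * \<bar>f\<bar> \<le> 1 * \<bar>f\<bar>"
      by (intro mult_right_mono) auto
    then show ?thesis by (simp add: left_diff_distrib flip: abs_mult)
  qed
  show ?thesis
  proof (rule that[of "c1 * exp (- \<bar>f\<bar>) * c2" "C1 * exp \<bar>f\<bar> * C2"])
    fix n
    let ?k = "nat \<lfloor>r * real n\<rfloor>"
    have U: "real n * U_V V t = r * real n * f + real n * h"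
      by (simp add: U_V_def f_def h_def algebra_simps)
    have "c1 * exp (- \<bar>f\<bar>) * c2 * exp (real n * U_V V t)
        = c1 * exp (- \<bar>f\<bar> + r * real n * f) * (c2 * exp (real n * h))"
      by (simp only: U exp_add mult_ac)
    also have "\<dots> \<le> c1 * exp (real ?k * f) * (c2 * exp (real n * h))"
      using floor[of n] c1(1) c2(1) by (intro mult_right_mono mult_left_mono) (auto simp: abs_le_iff)
    also have "\<dots> \<le> src_sum ?k t * chan_sum V n t"
      using c1 c2 by (intro mult_mono order_trans[OF _ c1(3)]) auto
    finally show "c1 * exp (- \<bar>f\<bar>) * c2 * exp (real n * U_V V t) \<le> src_sum ?k t * chan_sum V n t" .
    have "0 < c2 * exp (real n * h)" using c2(1) by simp
    then have "0 \<le> chan_sum V n t" using c2(3)[of n] by linarith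
    then have "src_sum ?k t * chan_sum V n t \<le> C1 * exp (real ?k * f) * (C2 * exp (real n * h))"
      using c1 c2 by (intro mult_mono) auto
    also have "\<dots> \<le> C1 * exp (\<bar>f\<bar> + r * real n * f) * (C2 * exp (real n * h))"
      using floor[of n] c1(2) c2(2) by (intro mult_right_mono mult_left_mono) (auto simp: abs_le_iff)
    also have "\<dots> = C1 * exp \<bar>f\<bar> * C2 * exp (real n * U_V V t)"
      by (simp only: U exp_add mult_ac)
    finally show "src_sum ?k t * chan_sum V n t \<le> C1 * exp \<bar>f\<bar> * C2 * exp (real n * U_V V t)" .
  qed (use c1 c2 in auto)
qed

end

subsection \<open>The error exponent\<close>

lemma eventually_const_le_exp:
  fixes A B \<delta> :: real
  assumes "0 < B" "0 < \<delta>"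
  shows "eventually (\<lambda>n. A \<le> B * exp (real n * \<delta>)) sequentially"
  using eventually_ge_at_top[of "nat \<lceil>A / (B * \<delta>)\<rceil>"]
proof (rule eventually_mono)
  fix n assume "nat \<lceil>A / (B * \<delta>)\<rceil> \<le> n"
  then have "A / (B * \<delta>) \<le> real n" by linarith
  then have "A \<le> B * (real n * \<delta>)" using assms by (simp add: divide_le_eq mult_ac)
  also have "\<dots> \<le> B * exp (real n * \<delta>)"
    using assms(1) exp_ge_add_one_self[of "real n * \<delta>"] by (intro mult_left_mono; linarith)
  finally show "A \<le> B * exp (real n * \<delta>)" .
qed

lemma limsup_neg_log_rate_le:
  assumes c: "0 < c" and le: "eventually (\<lambda>n. c * exp (- real n * B) \<le> p n) sequentially"
  shows "limsup (\<lambda>n. neg_log_rate n (p n)) \<le> ereal B"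
proof -
  have "limsup (\<lambda>n. neg_log_rate n (p n)) \<le> limsup (\<lambda>n. ereal (B - ln c / real n))"
  proof (rule Limsup_mono)
    show "eventually (\<lambda>n. neg_log_rate n (p n) \<le> ereal (B - ln c / real n)) sequentially"
      using le eventually_gt_at_top[of 0]
    proof eventually_elim
      case (elim n)
      have pos: "0 < c * exp (- real n * B)" using c by simp
      then have "ln (c * exp (- real n * B)) \<le> ln (p n)" using elim by (intro ln_mono) auto
      then have "ln c - real n * B \<le> ln (p n)" using c by (simp add: ln_mult)
      then have "- (1 / real n) * ln (p n) \<le> B - ln c / real n"
        using elim(2) by (simp add: field_simps)
      moreover have "p n \<noteq> 0" using pos elim(1) by linarith
      ultimately show ?case by (simp add: neg_log_rate_def)
    qed
  qed
  also have "((\<lambda>n. B - ln c / real n) \<longlonglongrightarrow> B)"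
  proof -
    have "((\<lambda>n. B - ln c / real n) \<longlonglongrightarrow> B - 0)"
      by (intro tendsto_intros lim_const_over_n)
    then show ?thesis by simp
  qed
  then have "limsup (\<lambda>n. ereal (B - ln c / real n)) = ereal B"
    by (intro lim_imp_Limsup) auto
  finally show ?thesis .
qed

context coding
begin

lemma avg_err_nonneg: "0 \<le> avg_err PM1 Ws PXZ1 Wc k n e d"
proof -
  have "0 \<le> PM1 m" "0 \<le> PXZ1 xz" for m xz
    using PM1 PXZ1 by (simp_all add: distribution_def del: split_paired_All)
  then show ?thesis
    unfolding avg_err_def
    by (intro sum_nonneg mult_nonneg_nonneg mc_prob_nonneg) (simp_all add: Ws_nonneg Wc_nonneg mc_prob_nonneg)
qed

text \<open>If the chord of \<open>U_V V\<close> through \<open>\<theta>1\<close> and \<open>\<theta>\<close> exceeds \<open>ln CARD('x)\<close> at \<open>1\<close>, correct decoding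
  is negligible under the \<open>\<theta>\<close>-tilted weights, and the error exponent is at most minus the value
  at \<open>0\<close> of the chord through \<open>\<theta>\<close> and \<open>\<theta>2\<close>.\<close>
lemma converse_rate_V:
  assumes V: "admissible_V Wc V"
    and th: "\<theta>1 < \<theta>" "\<theta> < \<theta>2" "0 < \<theta>" "\<theta> < 1"
  defines "\<alpha> \<equiv> (1 - \<theta>) / (1 - \<theta>1)" and "\<beta> \<equiv> \<theta> / \<theta>2"
  assumes gap: "\<alpha> * U_V V \<theta>1 + (1 - \<alpha>) * ln (real CARD('x)) < U_V V \<theta>"
  shows "limsup (\<lambda>n. neg_log_rate n (Pj PM1 Ws PXZ1 Wc (nat \<lfloor>r * real n\<rfloor>) n))
    \<le> ereal ((\<beta> * U_V V \<theta>2 - U_V V \<theta>) / (1 - \<beta>))"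
proof -
  define F where "F = U_V V"
  define R where "R = ln (real CARD('x))"
  define k where "k n = nat \<lfloor>r * real n\<rfloor>" for n
  have al: "0 < \<alpha>" "\<alpha> < 1" and be: "0 < \<beta>" "\<beta> < 1" using th by (auto simp: \<alpha>_def \<beta>_def)
  obtain c where c: "0 < c" "\<And>n. c * exp (real n * F \<theta>) \<le> src_sum (k n) \<theta> * chan_sum V n \<theta>"
    using total_sum_bounds[OF V, of \<theta>] unfolding F_def k_def by metis
  have upper: "\<exists>C>0. \<forall>n. 0 \<le> src_sum (k n) t * chan_sum V n t \<and>
      src_sum (k n) t * chan_sum V n t \<le> C * exp (real n * F t)" for t
  proof -
    obtain c C where cC: "0 < c" "0 < C" "\<And>n. c * exp (real n * F t) \<le> src_sum (k n) t * chan_sum V n t"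
      "\<And>n. src_sum (k n) t * chan_sum V n t \<le> C * exp (real n * F t)"
      using total_sum_bounds[OF V, of t] unfolding F_def k_def by metis
    have "0 \<le> src_sum (k n) t * chan_sum V n t" for n
      using cC(1) cC(3)[of n] by (meson exp_ge_zero less_imp_le mult_nonneg_nonneg order_trans)
    then show ?thesis using cC by blast
  qed
  obtain C1 where C1: "0 < C1" "\<And>n. 0 \<le> src_sum (k n) \<theta>1 * chan_sum V n \<theta>1"
    "\<And>n. src_sum (k n) \<theta>1 * chan_sum V n \<theta>1 \<le> C1 * exp (real n * F \<theta>1)"
    using upper[of \<theta>1] by blast
  obtain C2 where C2: "0 < C2" "\<And>n. 0 \<le> src_sum (k n) \<theta>2 * chan_sum V n \<theta>2"
    "\<And>n. src_sum (k n) \<theta>2 * chan_sum V n \<theta>2 \<le> C2 * exp (real n * F \<theta>2)"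
    using upper[of \<theta>2] by blast
  define B where "B = (\<beta> * F \<theta>2 - F \<theta>) / (1 - \<beta>)"
  \<comment> \<open>Half of the lower constant \<open>c\<close> is reserved for the decoding errors;
    the rest of \<open>K\<close> clears the constant of the \<theta>2-sum.\<close>
  define K where "K = c / 2 / C2 powr \<beta>"
  have K: "0 < K" using c(1) C2(1) by (simp add: K_def)
  \<comment> \<open>From here on correct decoding takes at most the other half. The threshold does
    not depend on the code, so the bound passes to the infimum over codes.\<close>
  have "eventually (\<lambda>n. C1 powr \<alpha> \<le> c / 2 * exp (real n * (F \<theta> - (\<alpha> * F \<theta>1 + (1 - \<alpha>) * R)))) sequentially"
    using c(1) gap by (intro eventually_const_le_exp) (auto simp: F_def R_def)
  then have "eventually (\<lambda>n. K powr (1 / (1 - \<beta>)) * exp (- real n * B) \<le> Pj PM1 Ws PXZ1 Wc (k n) n) sequentially"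
  proof (rule eventually_mono)
    fix n
    assume n: "C1 powr \<alpha> \<le> c / 2 * exp (real n * (F \<theta> - (\<alpha> * F \<theta>1 + (1 - \<alpha>) * R)))"
    let ?G = "\<alpha> * F \<theta>1 + (1 - \<alpha>) * R"
    have code: "K powr (1 / (1 - \<beta>)) * exp (- real n * B) \<le> avg_err PM1 Ws PXZ1 Wc (k n) n e d"
      if len: "\<forall>ms. length ms = k n \<longrightarrow> length (e ms) = n" for e d
    proof -
      let ?P = "avg_err PM1 Ws PXZ1 Wc (k n) n e d"
      have "(src_sum (k n) \<theta>1 * chan_sum V n \<theta>1) powr \<alpha> * (real CARD('x) ^ n) powr (1 - \<alpha>)
          \<le> (C1 * exp (real n * F \<theta>1)) powr \<alpha> * (exp (real n * R)) powr (1 - \<alpha>)"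
      proof -
        have "real CARD('x) ^ n = exp (real n * R)" by (simp add: R_def exp_of_nat_mult)
        then show ?thesis
          using al C1(2,3)[of n] by (simp only:) (intro mult_right_mono powr_mono2; simp)
      qed
      also have "\<dots> = C1 powr \<alpha> * exp (real n * ?G)"
        using C1(1) by (simp add: powr_mult exp_powr_real algebra_simps flip: exp_add)
      also have "\<dots> \<le> c / 2 * exp (real n * (F \<theta> - ?G)) * exp (real n * ?G)"
        using n by (intro mult_right_mono) auto
      also have "\<dots> = c / 2 * exp (real n * F \<theta>)"
        by (simp add: algebra_simps flip: exp_add)
      finally have corr: "(src_sum (k n) \<theta>1 * chan_sum V n \<theta>1) powr \<alpha> * (real CARD('x) ^ n) powr (1 - \<alpha>)
          \<le> c / 2 * exp (real n * F \<theta>)" .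
      have "(src_sum (k n) \<theta>2 * chan_sum V n \<theta>2) powr \<beta> * ?P powr (1 - \<beta>)
          \<le> (C2 * exp (real n * F \<theta>2)) powr \<beta> * ?P powr (1 - \<beta>)"
        using be C2 by (intro mult_right_mono powr_mono2) auto
      also have "\<dots> = C2 powr \<beta> * exp (real n * (\<beta> * F \<theta>2)) * ?P powr (1 - \<beta>)"
        using C2(1) by (simp add: powr_mult exp_powr_real mult_ac)
      finally have err: "(src_sum (k n) \<theta>2 * chan_sum V n \<theta>2) powr \<beta> * ?P powr (1 - \<beta>) \<le> \<dots>" .
      have os: "src_sum (k n) \<theta> * chan_sum V n \<theta>
          \<le> (src_sum (k n) \<theta>1 * chan_sum V n \<theta>1) powr \<alpha> * (real CARD('x) ^ n) powr (1 - \<alpha>)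
          + (src_sum (k n) \<theta>2 * chan_sum V n \<theta>2) powr \<beta> * ?P powr (1 - \<beta>)"
        unfolding \<alpha>_def \<beta>_def by (rule one_shot_converse[OF V _ th]) (use len in blast)
      have "c / 2 * exp (real n * F \<theta>) \<le> C2 powr \<beta> * exp (real n * (\<beta> * F \<theta>2)) * ?P powr (1 - \<beta>)"
        using os err corr c(2)[of n] by linarith
      moreover have "exp (real n * F \<theta>) = exp (real n * (\<beta> * F \<theta>2)) * exp (- real n * (\<beta> * F \<theta>2 - F \<theta>))"
        by (simp add: algebra_simps flip: exp_add)
      ultimately have "exp (real n * (\<beta> * F \<theta>2)) * (K * exp (- real n * (\<beta> * F \<theta>2 - F \<theta>)))
          \<le> exp (real n * (\<beta> * F \<theta>2)) * ?P powr (1 - \<beta>)"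
        using C2(1) by (simp add: K_def field_simps)
      then have "K * exp (- real n * (\<beta> * F \<theta>2 - F \<theta>)) \<le> ?P powr (1 - \<beta>)"
        by simp
      then have "(K * exp (- real n * (\<beta> * F \<theta>2 - F \<theta>))) powr (1 / (1 - \<beta>))
          \<le> (?P powr (1 - \<beta>)) powr (1 / (1 - \<beta>))"
        using be K by (intro powr_mono2) auto
      moreover have "(?P powr (1 - \<beta>)) powr (1 / (1 - \<beta>)) = ?P"
        using be avg_err_nonneg[of "k n" n e d] by (simp add: powr_powr)
      moreover have "(K * exp (- real n * (\<beta> * F \<theta>2 - F \<theta>))) powr (1 / (1 - \<beta>))
          = K powr (1 / (1 - \<beta>)) * exp (- real n * B)"
        using K by (simp add: powr_mult exp_powr_real B_def)
      ultimately show ?thesis by simp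
    qed
    show "K powr (1 / (1 - \<beta>)) * exp (- real n * B) \<le> Pj PM1 Ws PXZ1 Wc (k n) n"
      unfolding Pj_def
    proof (rule cInf_greatest)
      let ?S = "{avg_err PM1 Ws PXZ1 Wc (k n) n e d |e d. \<forall>ms. length ms = k n \<longrightarrow> length (e ms) = n}"
      have "avg_err PM1 Ws PXZ1 Wc (k n) n (\<lambda>_. replicate n 0) (\<lambda>_. []) \<in> ?S"
        by (intro CollectI exI conjI) (rule refl, simp)
      then show "?S \<noteq> {}" by auto
      fix P assume "P \<in> ?S"
      then obtain e d where P: "P = avg_err PM1 Ws PXZ1 Wc (k n) n e d"
        and len: "\<forall>ms. length ms = k n \<longrightarrow> length (e ms) = n" by (elim CollectE exE conjE)
      show "K powr (1 / (1 - \<beta>)) * exp (- real n * B) \<le> P"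
        unfolding P by (rule code[OF len])
    qed
  qed
  moreover have "0 < K powr (1 / (1 - \<beta>))" using K by simp
  ultimately show ?thesis
    unfolding k_def[symmetric] F_def[symmetric] B_def[symmetric] by (intro limsup_neg_log_rate_le)
qed

text \<open>Passing from \<open>U_V V\<close> to \<open>U\<close>: the gap and the rate need a lower
  bound at \<theta>, given by the choice of \<open>V\<close>, and upper bounds at \<theta>1 and
  \<theta>2, which hold for every \<open>V\<close>. One part of \<open>\<delta>\<close> preserves
  the gap, the other keeps the loss at \<epsilon> after division by
  \<open>1 - \<beta>\<close>.\<close>

lemma converse_rate:
  assumes th: "0 \<le> \<theta>1" "\<theta>1 < \<theta>" "\<theta> < \<theta>2" "\<theta>2 \<le> 1"
  defines "\<alpha> \<equiv> (1 - \<theta>) / (1 - \<theta>1)" and "\<beta> \<equiv> \<theta> / \<theta>2"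
  assumes gap: "\<alpha> * U \<theta>1 + (1 - \<alpha>) * ln (real CARD('x)) < U \<theta>"
  shows "limsup (\<lambda>n. neg_log_rate n (Pj PM1 Ws PXZ1 Wc (nat \<lfloor>r * real n\<rfloor>) n))
    \<le> ereal ((\<beta> * U \<theta>2 - U \<theta>) / (1 - \<beta>))"
proof (rule ereal_le_epsilon2)
  fix \<epsilon> :: real assume eps: "0 < \<epsilon>"
  have al: "0 < \<alpha>" "\<alpha> < 1" and be: "0 < \<beta>" "\<beta> < 1" using th by (auto simp: \<alpha>_def \<beta>_def)
  define \<delta> where "\<delta> = min (\<epsilon> * (1 - \<beta>)) (U \<theta> - (\<alpha> * U \<theta>1 + (1 - \<alpha>) * ln (real CARD('x))))"
  have "0 < \<delta>" using eps be gap by (simp add: \<delta>_def)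
  then obtain V where V: "admissible_V Wc V" "U \<theta> - \<delta> < U_V V \<theta>"
    using U_V_approx[of \<theta> \<delta>] th by auto
  have "\<alpha> * U_V V \<theta>1 \<le> \<alpha> * U \<theta>1" "\<beta> * U_V V \<theta>2 \<le> \<beta> * U \<theta>2"
    using al be th by (intro mult_left_mono U_V_le_U V(1); simp)+
  moreover have "\<delta> \<le> \<epsilon> * (1 - \<beta>)" "\<delta> \<le> U \<theta> - (\<alpha> * U \<theta>1 + (1 - \<alpha>) * ln (real CARD('x)))"
    by (simp_all add: \<delta>_def)
  ultimately have gap': "\<alpha> * U_V V \<theta>1 + (1 - \<alpha>) * ln (real CARD('x)) < U_V V \<theta>"
    and le: "\<beta> * U_V V \<theta>2 - U_V V \<theta> \<le> (\<beta> * U \<theta>2 - U \<theta>) + \<epsilon> * (1 - \<beta>)"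
    using V(2) by linarith+
  have "limsup (\<lambda>n. neg_log_rate n (Pj PM1 Ws PXZ1 Wc (nat \<lfloor>r * real n\<rfloor>) n))
      \<le> ereal ((\<beta> * U_V V \<theta>2 - U_V V \<theta>) / (1 - \<beta>))"
    using gap' th unfolding \<alpha>_def \<beta>_def by (intro converse_rate_V[OF V(1)]) auto
  also have "\<dots> \<le> ereal ((\<beta> * U \<theta>2 - U \<theta>) / (1 - \<beta>) + \<epsilon>)"
    using divide_right_mono[OF le, of "1 - \<beta>"] be by (simp add: add_divide_distrib)
  finally show "limsup (\<lambda>n. neg_log_rate n (Pj PM1 Ws PXZ1 Wc (nat \<lfloor>r * real n\<rfloor>) n))
      \<le> ereal ((\<beta> * U \<theta>2 - U \<theta>) / (1 - \<beta>)) + ereal \<epsilon>" by simp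
qed

text \<open>Convexity alone would let \<open>U\<close> jump upwards at 1. But some
  \<open>U_V V\<close> already exceeds \<open>c\<close> there, is continuous on the whole line, and
  lies below \<open>U\<close>.\<close>

lemma U_exceeds_near_1:
  assumes "c < U 1" "L \<midarrow>1\<rightarrow> c" "\<theta>0 < 1"
  shows "\<exists>t. \<theta>0 < t \<and> t < 1 \<and> L t < U t"
proof -
  obtain V where V: "admissible_V Wc V" "c < U_V V 1"
    using U_V_approx[of 1 "U 1 - c"] assms(1) by auto
  have "continuous_on UNIV (U_V V)"
    by (intro convex_on_continuous U_V_convex V) simp
  then have "U_V V \<midarrow>1\<rightarrow> U_V V 1"
    by (simp add: continuous_on_eq_continuous_at isCont_def)
  then have "(\<lambda>t. U_V V t - L t) \<midarrow>1\<rightarrow> U_V V 1 - c"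
    by (intro tendsto_diff assms(2))
  then have "eventually (\<lambda>t. 0 < U_V V t - L t) (at 1)"
    using V(2) by (intro order_tendstoD(1)) auto
  then have "eventually (\<lambda>t. 0 < U_V V t - L t) (at_left 1)"
    by (simp add: eventually_at_split)
  moreover have "eventually (\<lambda>t. t \<in> {max 0 \<theta>0<..<1}) (at_left 1)"
    using assms(3) by (intro eventually_at_leftI[of "max 0 \<theta>0"]) auto
  ultimately have "eventually (\<lambda>t. \<theta>0 < t \<and> t < 1 \<and> L t < U t) (at_left 1)"
  proof eventually_elim
    case (elim t)
    then show ?case using U_V_le_U[OF _ _ V(1), of t] by auto
  qed
  then show ?thesis using eventually_happens' trivial_limit_at_left_real by blast
qed

text \<open>\<open>G\<close> is the gap between \<open>U\<close> and its tangent at \<open>\<theta>0\<close>; the tangent takes the value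
  \<open>ln CARD('x)\<close> at \<open>1\<close>. \<open>U\<close> need not be strictly convex, so the tilting parameters approach the
  last zero \<open>s\<close> of \<open>G\<close> from above; \<open>s < 1\<close> because \<open>ln CARD('x) < U 1\<close>.\<close>
lemma converse_exponent:
  assumes th0: "0 < \<theta>0" "\<theta>0 < 1"
    and D: "(U has_real_derivative D) (at \<theta>0)"
    and R: "(1 - \<theta>0) * D + U \<theta>0 = ln (real CARD('x))" "ln (real CARD('x)) < U 1"
    and tangent: "\<And>t. 0 \<le> t \<Longrightarrow> t < 1 \<Longrightarrow> U \<theta>0 + D * (t - \<theta>0) \<le> U t"
  shows "limsup (\<lambda>n. neg_log_rate n (Pj PM1 Ws PXZ1 Wc (nat \<lfloor>r * real n\<rfloor>) n)) \<le> ereal (\<theta>0 * D - U \<theta>0)"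
    (is "?lim \<le> _")
proof -
  define R where "R = ln (real CARD('x))"
  define G where "G t = U t - (U \<theta>0 + D * (t - \<theta>0))" for t
  have G_nn: "0 \<le> G t" if "0 \<le> t" "t < 1" for t using tangent[OF that] by (simp add: G_def)
  have R_eq: "R = U \<theta>0 + D * (1 - \<theta>0)" using R(1) by (simp add: R_def mult.commute)
  have "(\<lambda>t. U \<theta>0 + D * (t - \<theta>0)) \<midarrow>1\<rightarrow> R" unfolding R_eq by (intro tendsto_intros)
  then obtain q where q: "\<theta>0 < q" "q < 1" "0 < G q"
    using U_exceeds_near_1[of R _ \<theta>0] R(2) th0 by (auto simp: R_def G_def)
  have G_conv: "convex_on {0..1} G"
  proof -
    have eq: "G = (\<lambda>t. U t + (- (U \<theta>0 + D * (t - \<theta>0))))" by (simp add: fun_eq_iff G_def)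
    show ?thesis
      unfolding eq by (intro convex_on_add U_convex) (auto intro!: convex_onI simp: algebra_simps)
  qed
  have G_diff: "G differentiable (at t)" if "0 < t" "t < 1" for t
    unfolding G_def by (intro derivative_intros U_differentiable that)
  have G_cont: "continuous_on {\<theta>0..q} G"
    using G_diff th0 q by (intro differentiable_imp_continuous_on)
      (auto simp: differentiable_on_def intro: differentiable_at_withinI)
  define Z where "Z = {t \<in> {\<theta>0..q}. G t = 0}"
  have "compact Z"
    unfolding Z_def using continuous_closed_preimage_constant[OF G_cont, of 0]
    by (auto simp: compact_eq_bounded_closed intro: bounded_subset[of "{\<theta>0..q}"])
  moreover have "\<theta>0 \<in> Z" using q by (simp add: Z_def G_def)
  ultimately obtain s where s: "s \<in> Z" "\<And>t. t \<in> Z \<Longrightarrow> t \<le> s"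
    using compact_attains_sup[of Z] by blast
  have s01: "0 < s" "s < q" "G s = 0"
    using s(1) q th0 by (auto simp: Z_def less_le)
  have G_pos: "0 < G t" if t: "s < t" "t < 1" for t
  proof (rule ccontr)
    assume "\<not> 0 < G t"
    then have G0: "G t = 0" using G_nn[of t] s01 t by force
    \<comment> \<open>Up to \<open>q\<close> the maximality of \<open>s\<close> decides; beyond it,
      zeros at \<open>s\<close> and \<open>t\<close> would by convexity force \<open>G q\<close>
      down to 0.\<close>
    show False
    proof (cases "t \<le> q")
      case True
      then have "t \<in> Z" using G0 s01 t s(1) by (simp add: Z_def)
      then show False using s(2) t by force
    next
      case False
      define v where "v = (q - s) / (t - s)"
      have v: "0 \<le> v" "v \<le> 1" using False s01 by (auto simp: v_def)
      have "v * (t - s) = q - s" using False s01 by (simp add: v_def)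
      then have "q = (1 - v) * s + v * t" by (simp add: algebra_simps)
      then have "G q \<le> (1 - v) * G s + v * G t"
        using convex_onD[OF G_conv v, of s t] s01 t q by simp
      then show False using G0 s01 q by simp
    qed
  qed
  \<comment> \<open>\<open>s\<close> is an interior minimum of \<open>G\<close>. Hence
    \<open>G (s + 2 * h)\<close> is of smaller order than \<open>h\<close>, which makes the excess
    over the claimed exponent vanish.\<close>
  have "DERIV G s :> 0"
  proof -
    obtain D' where D': "DERIV G s :> D'"
      using G_diff[of s] s01 q real_differentiable_def by auto
    have "D' = 0"
    proof (rule DERIV_local_min[OF D', of "min s (1 - s)"])
      show "\<forall>y. \<bar>s - y\<bar> < min s (1 - s) \<longrightarrow> G s \<le> G y"
        using G_nn s01 by auto
    qed (use s01 q in auto)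
    then show ?thesis using D' by simp
  qed
  then have "((\<lambda>h. (G (s + h) - G s) / h) \<longlongrightarrow> 0) (at 0)" by (simp add: DERIV_def)
  then have "((\<lambda>h. G (s + h) / h) \<longlongrightarrow> 0) (at_right 0)"
    by (simp add: s01 filterlim_at_split)
  then have "((\<lambda>h. G (s + 2 * h) / (2 * h)) \<longlongrightarrow> 0) (at_right 0)"
  proof (rule filterlim_compose)
    show "filterlim (\<lambda>h::real. 2 * h) (at_right 0) (at_right 0)"
      unfolding filterlim_at by (auto intro!: tendsto_eq_intros eventually_at_rightI[of 0 1])
  qed
  then have "((\<lambda>h. \<theta>0 * D - U \<theta>0 + 2 * (s + h) * (G (s + 2 * h) / (2 * h)))
      \<longlongrightarrow> \<theta>0 * D - U \<theta>0 + 2 * (s + 0) * 0) (at_right 0)"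
    by (intro tendsto_intros) auto
  then have "((\<lambda>h. ereal (\<theta>0 * D - U \<theta>0 + 2 * (s + h) * (G (s + 2 * h) / (2 * h))))
      \<longlongrightarrow> ereal (\<theta>0 * D - U \<theta>0)) (at_right 0)"
    by simp
  moreover have "eventually (\<lambda>h. ?lim \<le> ereal (\<theta>0 * D - U \<theta>0 + 2 * (s + h) * (G (s + 2 * h) / (2 * h)))) (at_right 0)"
  proof (rule eventually_at_rightI[of 0 "(1 - s) / 2"])
    fix h assume "h \<in> {0<..<(1 - s) / 2}"
    then have h: "0 < h" "s + 2 * h < 1" by auto
    \<comment> \<open>The parameters are \<open>s\<close>, \<open>s + h\<close> and
      \<open>s + 2 * h\<close>. Since \<open>U\<close> meets the tangent at \<open>s\<close>, the
      chord from \<open>s\<close> to the point at 1 is the tangent itself, and the gap condition is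
      just \<open>0 < G ?t\<close>.\<close>
    let ?t = "s + h" and ?t2 = "s + 2 * h"
    let ?a = "(1 - ?t) / (1 - s)" and ?b = "?t / ?t2"
    have U_eq: "U t = G t + (R - D * (1 - t))" for t by (simp add: G_def R_eq algebra_simps)
    have gap: "?a * U s + (1 - ?a) * R < U ?t"
    proof -
      have "?a * U s + (1 - ?a) * R = R - D * (?a * (1 - s))"
      proof -
        have "a * (R - D * (1 - s)) + (1 - a) * R = R - D * (a * (1 - s))" for a
          by (simp add: algebra_simps)
        then show ?thesis by (simp only: U_eq[of s] s01(3) add_0)
      qed
      also have "?a * (1 - s) = 1 - ?t" using h by simp
      finally show ?thesis using G_pos[of ?t] h by (simp add: U_eq[of ?t])
    qed
    have b: "1 - ?b = h / ?t2" using h s01 by (simp add: field_simps)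
    have "(?b * U ?t2 - U ?t) / (1 - ?b) = (?t * U ?t2 - ?t2 * U ?t) / h"
    proof -
      have "(t / T * A - B) / (h / T) = (t * A - T * B) / h" if "0 < T" for t T A B :: real
      proof -
        have "t / T * A - B = (t * A - T * B) / T" using that by (simp add: field_simps)
        then show ?thesis using that by simp
      qed
      then show ?thesis unfolding b using h s01 by simp
    qed
    also have "\<dots> = (?t * G ?t2 - ?t2 * G ?t) / h + (D - R)"
    proof -
      have "?t * U ?t2 - ?t2 * U ?t = (?t * G ?t2 - ?t2 * G ?t) + h * (D - R)"
        unfolding U_eq[of ?t] U_eq[of ?t2] by (simp add: algebra_simps)
      then show ?thesis using h by (simp add: add_divide_distrib)
    qed
    also have "\<dots> \<le> ?t * G ?t2 / h + (D - R)"
      using h s01 G_nn[of ?t] by (simp add: divide_right_mono)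
    also have "\<dots> = \<theta>0 * D - U \<theta>0 + 2 * ?t * (G ?t2 / (2 * h))"
    proof -
      have "t * x / h = 2 * t * (x / (2 * h))" for t x using h by simp
      then have "?t * G ?t2 / h = 2 * ?t * (G ?t2 / (2 * h))" .
      moreover have "D - R = \<theta>0 * D - U \<theta>0" by (simp add: R_eq algebra_simps)
      ultimately show ?thesis by linarith
    qed
    finally have "(?b * U ?t2 - U ?t) / (1 - ?b) \<le> \<theta>0 * D - U \<theta>0 + 2 * ?t * (G ?t2 / (2 * h))" .
    moreover have "?lim \<le> ereal ((?b * U ?t2 - U ?t) / (1 - ?b))"
      using gap h s01 unfolding R_def by (intro converse_rate) auto
    ultimately show "?lim \<le> ereal (\<theta>0 * D - U \<theta>0 + 2 * ?t * (G ?t2 / (2 * h)))"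
      using order_trans ereal_less_eq(3) by blast
  qed (use s01 q in auto)
  ultimately show ?thesis
    by (rule tendsto_lowerbound) simp
qed

end

theorem mainTheorem15:
  fixes PM1 :: "'m::finite \<Rightarrow> real" and Ws :: "'m \<Rightarrow> 'm \<Rightarrow> real"
    and PXZ1 :: "'x::{finite,ab_group_add} \<times> 'z::finite \<Rightarrow> real"
    and Wc :: "'x \<times> 'z \<Rightarrow> 'x \<times> 'z \<Rightarrow> real"
    and r R \<theta>0 :: real
  assumes "distribution PM1" and "irred_aperiodic_transition Ws"
    and "distribution PXZ1" and "irred_aperiodic_transition Wc"
    and "assumption2 Wc"
    and "r > 0"
    and "R = ln (real CARD('x))"
    and "r * H_src Ws 0 + H_cond Wc < R"
    and "R < r * H_src Ws 1 + H_up Wc 1"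
    and "0 < \<theta>0" and "\<theta>0 < 1"
    and "(1 - \<theta>0) * deriv (U_up Ws Wc r) \<theta>0 + U_up Ws Wc r \<theta>0 = R"
  shows "(limsup (\<lambda>n. neg_log_rate n (Pj PM1 Ws PXZ1 Wc (nat \<lfloor>r * real n\<rfloor>) n))
           \<le> ereal (\<theta>0 * deriv (U_up Ws Wc r) \<theta>0 - U_up Ws Wc r \<theta>0))
         \<and> ereal (\<theta>0 * deriv (U_up Ws Wc r) \<theta>0 - U_up Ws Wc r \<theta>0)
           = (SUP \<theta>\<in>{0..<1}. ereal ((\<theta> * R - U_up Ws Wc r \<theta>) / (1 - \<theta>)))"
proof -
  interpret coding Wc Ws r PM1 PXZ1
    by unfold_locales (use assms in auto)
  define D where "D = deriv U \<theta>0"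
  have D: "(U has_real_derivative D) (at \<theta>0)"
    using U_differentiable[OF assms(10,11)] unfolding D_def real_differentiable_def
    by (metis DERIV_imp_deriv)
  have R: "(1 - \<theta>0) * D + U \<theta>0 = R" using assms(12) by (simp add: D_def)
  have tangent: "U \<theta>0 + D * (t - \<theta>0) \<le> U t" if "0 \<le> t" "t < 1" for t
    using convex_on_imp_above_tangent[OF U_convex, of \<theta>0 t D] that assms(10,11) D
    by (auto simp: has_field_derivative_at_within)
  have "limsup (\<lambda>n. neg_log_rate n (Pj PM1 Ws PXZ1 Wc (nat \<lfloor>r * real n\<rfloor>) n)) \<le> ereal (\<theta>0 * D - U \<theta>0)"
    using assms(7,9) R by (intro converse_exponent assms(10,11) D tangent) (auto simp: U_up_def)
  \<comment> \<open>\<open>(U t - t * R) / (1 - t)\<close> is the value at 0 of the line through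
    \<open>(t, U t)\<close> and \<open>(1, R)\<close>. As \<open>U\<close> lies above its tangent at
    \<theta>0, which also passes through \<open>(1, R)\<close>, this value is smallest for the
    tangent.\<close>
  moreover have "ereal (\<theta>0 * D - U \<theta>0) = (SUP \<theta>\<in>{0..<1}. ereal ((\<theta> * R - U \<theta>) / (1 - \<theta>)))"
  proof (rule antisym)
    have "\<theta>0 * R - U \<theta>0 = (1 - \<theta>0) * (\<theta>0 * D - U \<theta>0)"
      unfolding R[symmetric] by (simp add: algebra_simps)
    then have "\<theta>0 * D - U \<theta>0 = (\<theta>0 * R - U \<theta>0) / (1 - \<theta>0)"
      using assms(11) by simp
    then show "ereal (\<theta>0 * D - U \<theta>0) \<le> (SUP \<theta>\<in>{0..<1}. ereal ((\<theta> * R - U \<theta>) / (1 - \<theta>)))"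
      using assms(10,11) by (intro SUP_upper2[of \<theta>0]) auto
    show "(SUP \<theta>\<in>{0..<1}. ereal ((\<theta> * R - U \<theta>) / (1 - \<theta>))) \<le> ereal (\<theta>0 * D - U \<theta>0)"
    proof (rule SUP_least)
      fix t :: real assume t: "t \<in> {0..<1}"
      have "t * R - U t \<le> t * R - (U \<theta>0 + D * (t - \<theta>0))" using tangent[of t] t by simp
      also have "\<dots> = (1 - t) * (\<theta>0 * D - U \<theta>0)"
        unfolding R[symmetric] by (simp add: algebra_simps)
      finally show "ereal ((t * R - U t) / (1 - t)) \<le> ereal (\<theta>0 * D - U \<theta>0)"
        using t by (simp add: divide_le_eq mult.commute)
    qed
  qed
  ultimately show ?thesis by (simp add: D_def)
qed

end
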